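(* Let $q\ge2$ and $p>q+1$. Let $(F_0,F_\infty)$ be a pair of transverse flags in $\mathrm{SO}_0(p,q)/P_{1,\dots,q}$, let $\pi:\mathrm{SO}_0(p,q)/P_{1,\dots,q}\to\mathrm{SO}_0(p,q)/P_{1,\dots,q-1}$ be the projection forgetting the $q$-dimensional subspace. Then the map $$\pi_0\big(\Omega(F_0)\cap\Omega(F_\infty)\big)\longrightarrow\pi_0\big(\Omega(\pi(F_0))\cap\Omega(\pi(F_\infty))\big)$$ induced by $\pi$ is bijective.
   Context: $\mathbb{R}^{p,q}$ is $\mathbb{R}^{p+q}$ with a nondegenerate symmetric bilinear form of signature $(p,q)$, and $\mathrm{SO}_0(p,q)$ is the identity component of its isometry group. For $k\le q$, $\mathrm{SO}_0(p,q)/P_{1,\dots,k}$ is the space of flags $F=(F^1\subset\dots\subset F^{k})$ of isotropic subspaces with $\dim F^j=j$. Flags $F,G$ are transverse if $F^j\oplus(G^j)^\perp=\mathbb{R}^{p,q}$ for all $1\le j\le k$; $\Omega(F)$ is the set of flags (in the same flag variety) transverse to $F$. *)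

theory Defs
  imports "HOL-Analysis.Analysis"
begin

section \<open>Symmetric bilinear forms of signature (p,q)\<close>

definition symmetric_form :: "('a::euclidean_space \<Rightarrow> 'a \<Rightarrow> real) \<Rightarrow> bool" where
  "symmetric_form b \<longleftrightarrow> bilinear b \<and> (\<forall>x y. b x y = b y x)"

definition nondegenerate_form :: "('a::euclidean_space \<Rightarrow> 'a \<Rightarrow> real) \<Rightarrow> bool" where
  "nondegenerate_form b \<longleftrightarrow> (\<forall>x. (\<forall>y. b x y = 0) \<longrightarrow> x = 0)"

text \<open>Signature in the sense of Sylvester's law of inertia: some orthogonal basis has
  \<open>p\<close> positive and \<open>q\<close> negative vectors.\<close>

definition has_signature :: "('a::euclidean_space \<Rightarrow> 'a \<Rightarrow> real) \<Rightarrow> nat \<Rightarrow> nat \<Rightarrow> bool" where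
  "has_signature b p q \<longleftrightarrow>
     (\<exists>B. independent B \<and> span B = UNIV \<and> pairwise (\<lambda>x y. b x y = 0) B \<and>
          card {x \<in> B. b x x > 0} = p \<and> card {x \<in> B. b x x < 0} = q)"

definition orth_compl :: "('a::euclidean_space \<Rightarrow> 'a \<Rightarrow> real) \<Rightarrow> 'a set \<Rightarrow> 'a set" where
  "orth_compl b W = {x. \<forall>w\<in>W. b x w = 0}"

definition isotropic :: "('a::euclidean_space \<Rightarrow> 'a \<Rightarrow> real) \<Rightarrow> 'a set \<Rightarrow> bool" where
  "isotropic b W \<longleftrightarrow> (\<forall>x\<in>W. \<forall>y\<in>W. b x y = 0)"


section \<open>Grassmannians\<close>

definition grassmannian :: "nat \<Rightarrow> 'a::euclidean_space set set" where
  "grassmannian j = {W. subspace W \<and> dim W = j}"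

definition frame_space :: "nat \<Rightarrow> (nat \<Rightarrow> 'a::euclidean_space) topology" where
  "frame_space j = subtopology (product_topology (\<lambda>_. euclidean) {..<j})
                     {v. inj_on v {..<j} \<and> independent (v ` {..<j})}"

text \<open>The usual topology of the Grassmannian: the quotient of the space of linearly
  independent \<open>j\<close>-tuples by the map sending a tuple to its span.\<close>

definition grassmannian_topology :: "nat \<Rightarrow> 'a::euclidean_space set topology" where
  "grassmannian_topology j = topology (\<lambda>U. U \<subseteq> grassmannian j \<and>
     openin (frame_space j) {v \<in> topspace (frame_space j). span (v ` {..<j}) \<in> U})"

lemma openin_grassmannian:
  "openin (grassmannian_topology j) U \<longleftrightarrow> U \<subseteq> grassmannian j \<and>
     openin (frame_space j) {v \<in> topspace (frame_space j). span (v ` {..<j}) \<in> U}"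
proof -
  let ?X = "frame_space j :: (nat \<Rightarrow> 'a) topology"
  let ?s = "\<lambda>v :: nat \<Rightarrow> 'a. span (v ` {..<j})"
  have "istopology (\<lambda>U. U \<subseteq> grassmannian j \<and> openin ?X {v \<in> topspace ?X. ?s v \<in> U})"
    unfolding istopology_def
  proof (intro conjI allI impI)
    fix S T :: "'a set set"
    assume S: "S \<subseteq> grassmannian j \<and> openin ?X {v \<in> topspace ?X. ?s v \<in> S}"
      and T: "T \<subseteq> grassmannian j \<and> openin ?X {v \<in> topspace ?X. ?s v \<in> T}"
    show "S \<inter> T \<subseteq> grassmannian j" using S by blast
    have "{v \<in> topspace ?X. ?s v \<in> S \<inter> T} =
        {v \<in> topspace ?X. ?s v \<in> S} \<inter> {v \<in> topspace ?X. ?s v \<in> T}" by blast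
    then show "openin ?X {v \<in> topspace ?X. ?s v \<in> S \<inter> T}"
      using S T by (metis (no_types, lifting) openin_Int)
  next
    fix K :: "'a set set set"
    assume K: "\<forall>S\<in>K. S \<subseteq> grassmannian j \<and> openin ?X {v \<in> topspace ?X. ?s v \<in> S}"
    show "\<Union>K \<subseteq> grassmannian j" using K by blast
    have "{v \<in> topspace ?X. ?s v \<in> \<Union>K} = (\<Union>S\<in>K. {v \<in> topspace ?X. ?s v \<in> S})" by blast
    moreover have "openin ?X (\<Union>S\<in>K. {v \<in> topspace ?X. ?s v \<in> S})"
      using K by (intro openin_Union) auto
    ultimately show "openin ?X {v \<in> topspace ?X. ?s v \<in> \<Union>K}" by simp
  qed
  then show ?thesis
    unfolding grassmannian_topology_def by (simp add: topology_inverse')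
qed

lemma span_frame_in_grassmannian:
  assumes "v \<in> topspace (frame_space j :: (nat \<Rightarrow> 'a::euclidean_space) topology)"
  shows "span (v ` {..<j}) \<in> grassmannian j"
  using assms
  by (auto simp: frame_space_def grassmannian_def dim_eq_card_independent card_image)

lemma topspace_grassmannian: "topspace (grassmannian_topology j) = grassmannian j"
proof -
  have "{v \<in> topspace (frame_space j). span (v ` {..<j}) \<in> grassmannian j} =
      topspace (frame_space j :: (nat \<Rightarrow> 'a) topology)"
    using span_frame_in_grassmannian by blast
  then have "openin (grassmannian_topology j) (grassmannian j :: 'a set set)"
    by (simp add: openin_grassmannian)
  then show ?thesis
    by (meson openin_grassmannian openin_subset openin_topspace subset_antisym)
qed


section \<open>Flags of isotropic subspaces\<close>

text \<open>A flag \<open>F\<^sup>1 \<subset> \<dots> \<subset> F\<^sup>k\<close> is a function on \<open>{1..k}\<close>, extended by \<^const>\<open>undefined\<close>, so that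
  flags with the same subspaces are equal.\<close>

definition isotropic_flags :: "('a::euclidean_space \<Rightarrow> 'a \<Rightarrow> real) \<Rightarrow> nat \<Rightarrow> (nat \<Rightarrow> 'a set) set" where
  "isotropic_flags b k =
     {F \<in> (\<Pi>\<^sub>E j\<in>{1..k}. grassmannian j).
        (\<forall>j\<in>{1..k}. isotropic b (F j)) \<and> (\<forall>i\<in>{1..k}. \<forall>j\<in>{1..k}. i \<le> j \<longrightarrow> F i \<subseteq> F j)}"

definition flag_space :: "('a::euclidean_space \<Rightarrow> 'a \<Rightarrow> real) \<Rightarrow> nat \<Rightarrow> (nat \<Rightarrow> 'a set) topology" where
  "flag_space b k =
     subtopology (product_topology grassmannian_topology {1..k}) (isotropic_flags b k)"

lemma topspace_flag_space: "topspace (flag_space b k) = isotropic_flags b k"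
  by (auto simp: flag_space_def topspace_grassmannian isotropic_flags_def)

definition transverse ::
  "('a::euclidean_space \<Rightarrow> 'a \<Rightarrow> real) \<Rightarrow> nat \<Rightarrow> (nat \<Rightarrow> 'a set) \<Rightarrow> (nat \<Rightarrow> 'a set) \<Rightarrow> bool" where
  "transverse b k F G \<longleftrightarrow>
     (\<forall>j\<in>{1..k}. F j \<inter> orth_compl b (G j) = {0} \<and>
                 {x + y | x y. x \<in> F j \<and> y \<in> orth_compl b (G j)} = UNIV)"

definition Omega ::
  "('a::euclidean_space \<Rightarrow> 'a \<Rightarrow> real) \<Rightarrow> nat \<Rightarrow> (nat \<Rightarrow> 'a set) \<Rightarrow> (nat \<Rightarrow> 'a set) set" where
  "Omega b k F = {G \<in> isotropic_flags b k. transverse b k G F}"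

definition forget :: "nat \<Rightarrow> (nat \<Rightarrow> 'a set) \<Rightarrow> (nat \<Rightarrow> 'a set)" where
  "forget k F = restrict F {1..k}"

definition Omega2_space ::
  "('a::euclidean_space \<Rightarrow> 'a \<Rightarrow> real) \<Rightarrow> nat \<Rightarrow> (nat \<Rightarrow> 'a set) \<Rightarrow> (nat \<Rightarrow> 'a set)
     \<Rightarrow> (nat \<Rightarrow> 'a set) topology" where
  "Omega2_space b k F G = subtopology (flag_space b k) (Omega b k F \<inter> Omega b k G)"


section \<open>The map induced on path components\<close>

definition pi0_map :: "'b topology \<Rightarrow> ('a \<Rightarrow> 'b) \<Rightarrow> 'a set \<Rightarrow> 'b set" where
  "pi0_map Y f C = (THE D. D \<in> path_components_of Y \<and> f ` C \<subseteq> D)"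

lemma pi0_map_eq:
  assumes f: "continuous_map X Y f" and C: "C \<in> path_components_of X" and x: "x \<in> C"
  shows "pi0_map Y f C = path_component_of_set Y (f x)"
  unfolding pi0_map_def
proof (rule the_equality)
  have "x \<in> topspace X"
    using C x path_components_of_subset by blast
  then have fx: "f x \<in> topspace Y"
    using f by (auto simp: continuous_map_def)
  have fC: "path_connectedin Y (f ` C)"
    using f C path_connectedin_continuous_map_image path_connectedin_path_components_of by blast
  have "f x \<in> f ` C" using x by blast
  with fC have "f ` C \<subseteq> path_component_of_set Y (f x)"
    by (rule path_component_of_maximal)
  then show "path_component_of_set Y (f x) \<in> path_components_of Y \<and>
      f ` C \<subseteq> path_component_of_set Y (f x)"
    using fx by (simp add: path_component_in_path_components_of)
  fix D
  assume D: "D \<in> path_components_of Y \<and> f ` C \<subseteq> D"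
  then obtain y where y: "D = path_component_of_set Y y"
    unfolding path_components_of_def by blast
  then have "path_component_of Y y (f x)"
    using D x by blast
  then show "D = path_component_of_set Y (f x)"
    unfolding y by (metis path_component_of_equiv)
qed

text \<open>The forgetful map is a continuous map between the spaces in question, so that it does
  induce a map on path components.\<close>

lemma forget_isotropic_flags:
  assumes "l \<le> k" "F \<in> isotropic_flags b k"
  shows "forget l F \<in> isotropic_flags b l"
  using assms by (auto simp: isotropic_flags_def forget_def PiE_iff)

lemma forget_Omega:
  assumes "l \<le> k" "G \<in> Omega b k F"
  shows "forget l G \<in> Omega b l (forget l F)"
  using assms forget_isotropic_flags[of l k G b]
  by (auto simp: Omega_def transverse_def forget_def)

lemma continuous_map_forget:
  assumes "l \<le> k"
  shows "continuous_map (Omega2_space b k F G) (Omega2_space b l (forget l F) (forget l G)) (forget l)"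
proof -
  have "continuous_map (product_topology grassmannian_topology {1..k})
      (product_topology grassmannian_topology {1..l})
      (\<lambda>H :: nat \<Rightarrow> 'a set. restrict H {1..l})"
    unfolding continuous_map_componentwise
  proof (intro conjI ballI)
    fix j assume j: "j \<in> {1..l}"
    then have "continuous_map (product_topology grassmannian_topology {1..k})
        (grassmannian_topology j) (\<lambda>H :: nat \<Rightarrow> 'a set. H j)"
      using assms by (intro continuous_map_product_projection) auto
    with j show "continuous_map (product_topology grassmannian_topology {1..k})
        (grassmannian_topology j) (\<lambda>H :: nat \<Rightarrow> 'a set. restrict H {1..l} j)"
      by simp
  qed auto
  then have *: "continuous_map (product_topology grassmannian_topology {1..k})
      (product_topology grassmannian_topology {1..l})
      (forget l :: (nat \<Rightarrow> 'a set) \<Rightarrow> nat \<Rightarrow> 'a set)"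
    unfolding forget_def .
  show ?thesis
    unfolding Omega2_space_def flag_space_def subtopology_subtopology
  proof (intro continuous_map_into_subtopology continuous_map_from_subtopology *)
    show "forget l \<in> topspace (subtopology (product_topology grassmannian_topology {1..k})
        (isotropic_flags b k \<inter> (Omega b k F \<inter> Omega b k G)))
      \<rightarrow> isotropic_flags b l \<inter> (Omega b l (forget l F) \<inter> Omega b l (forget l G))"
      using forget_isotropic_flags[OF assms] forget_Omega[OF assms] by auto
  qed
qed

end

theory Submission
  imports Defs
begin

text \<open>Put \<open>k = q - 1\<close>. For \<open>G\<close> in the base write \<open>W = G\<^sup>k\<close>. The space
  \<open>F\<^sub>0\<^sup>q \<inter> W\<^sup>\<bottom>\<close> is an isotropic line, spanned by some \<open>l\<^sub>0\<close> outside \<open>W\<close>, and similarly for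
  \<open>F\<^sub>\<infinity>\<close>. A flag over \<open>G\<close> is an isotropic line \<open>[u]\<close> of the Lorentzian space \<open>W\<^sup>\<bottom> / W\<close>, and
  it is transverse to \<open>F\<^sub>0\<^sup>q\<close> and \<open>F\<^sub>\<infinity>\<^sup>q\<close> if and only if \<open>b(u, l\<^sub>0) \<noteq> 0\<close> and \<open>b(u, l\<^sub>\<infinity>) \<noteq> 0\<close>. So the
  fibre is a sphere of dimension \<open>p - q \<ge> 2\<close> without one or two points, which is path connected.
  Since \<open>l\<^sub>0\<close>, \<open>l\<^sub>\<infinity>\<close> and the projection to \<open>W\<^sup>\<bottom>\<close> along \<open>F\<^sub>0\<^sup>k\<close> depend continuously on \<open>G\<close>, the projection of
  flag spaces has local sections, and a surjection with path connected fibres and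
  local sections induces a bijection on path components.\<close>

section \<open>Path components and Grassmannians\<close>

text \<open>No global lift of the path is built. A local section carries short pieces of the path
  into \<open>X\<close>, path connectedness of the fibres absorbs the choice of end points, and
  connectedness of the unit interval glues the pieces.\<close>

lemma path_component_of_fibres:
  assumes fib: "\<And>x x'. \<lbrakk>x \<in> topspace X; x' \<in> topspace X; f x = f x'\<rbrakk> \<Longrightarrow> path_component_of X x x'"
    and sec: "\<And>y. y \<in> topspace Y \<Longrightarrow> \<exists>U s. openin Y U \<and> y \<in> U \<and>
                 continuous_map (subtopology Y U) X s \<and> (\<forall>z\<in>U. f (s z) = z)"
    and x: "x \<in> topspace X" and x': "x' \<in> topspace X"
    and pc: "path_component_of Y (f x) (f x')"
  shows "path_component_of X x x'"
proof -
  obtain g where g: "pathin Y g" and g0: "g 0 = f x" and g1: "g 1 = f x'"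
    using pc unfolding path_component_of_def by blast
  \<comment> \<open>Quantifying over all points of both fibres makes the relation independent of
    choices. Transitivity then needs the middle fibre to be nonempty, which is
    \<open>ex\<close>.\<close>
  define R where "R s t \<longleftrightarrow> (\<forall>z\<in>topspace X. \<forall>z'\<in>topspace X.
      f z = g s \<longrightarrow> f z' = g t \<longrightarrow> path_component_of X z z')" for s t
  have gY: "g t \<in> topspace Y" if "t \<in> {0..1}" for t
    using g that by (auto simp: pathin_def continuous_map_def)
  have ex: "\<exists>z\<in>topspace X. f z = g t" if t: "t \<in> {0..1}" for t
  proof -
    obtain U s where U: "openin Y U" "g t \<in> U" "continuous_map (subtopology Y U) X s"
        "\<forall>z\<in>U. f (s z) = z"
      using sec[OF gY[OF t]] by blast
    then have "s (g t) \<in> topspace X"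
      using gY[OF t] by (auto simp: continuous_map_def)
    then show ?thesis using U by blast
  qed
  have "R 0 1"
  proof (rule connected_equivalence_relation[where S = "{0..1::real}"])
    fix a b assume "R a b" then show "R b a"
      unfolding R_def by (metis path_component_of_sym)
  next
    fix a b c assume "R a b" "R b c" "b \<in> {0..1::real}"
    then show "R a c"
      using ex[of b] unfolding R_def by (metis path_component_of_trans)
  next
    fix a :: real assume a: "a \<in> {0..1}"
    obtain U s where U: "openin Y U" "g a \<in> U" "continuous_map (subtopology Y U) X s"
        "\<forall>z\<in>U. f (s z) = z"
      using sec[OF gY[OF a]] by blast
    have "openin (top_of_set {0..1}) {t \<in> topspace (top_of_set {0..1}). g t \<in> U}"
      using g U(1) unfolding pathin_def by (rule openin_continuous_map_preimage)
    then obtain e where e: "e > 0" "\<And>t. t \<in> {0..1} \<Longrightarrow> dist t a < e \<Longrightarrow> g t \<in> U"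
      using a U(2) unfolding openin_euclidean_subtopology_iff by auto
    have "R a t" if t: "t \<in> {0..1}" "dist t a < e" for t
      unfolding R_def
    proof (intro ballI impI)
      fix z z' assume z: "z \<in> topspace X" "z' \<in> topspace X" "f z = g a" "f z' = g t"
      \<comment> \<open>This parametrises the segment from \<open>a\<close> to \<open>t\<close>. The
        segment stays in the \<open>e\<close>-ball, so \<open>g \<circ> h\<close> stays in
        \<open>U\<close> and the section applies to it.\<close>
      define h where "h r = (1 - r) * a + r * t" for r :: real
      have h1: "h r \<in> closed_segment a t" if "r \<in> {0..1}" for r
        using that by (auto simp: h_def closed_segment_def)
      have seg: "closed_segment a t \<subseteq> {0..1}"
        using a t(1) by (simp add: closed_segment_subset)
      have hU: "h r \<in> {0..1} \<and> g (h r) \<in> U" if "r \<in> {0..1}" for r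
      proof -
        have "dist (h r) a \<le> dist a t"
          using segment_bound[OF h1[OF that]] by (simp add: dist_norm)
        then show ?thesis
          using e(2) seg h1[OF that] t(2) by (auto simp: dist_commute)
      qed
      have "continuous_map (top_of_set {0..1}) (top_of_set {0..1}) h"
        using hU by (auto simp: h_def intro!: continuous_intros)
      then have "continuous_map (top_of_set {0..1}) Y (g \<circ> h)"
        using g continuous_map_compose unfolding pathin_def by blast
      then have "continuous_map (top_of_set {0..1}) (subtopology Y U) (g \<circ> h)"
        using hU by (auto intro: continuous_map_into_subtopology)
      then have "pathin X (s \<circ> (g \<circ> h))"
        using U(3) unfolding pathin_def by (rule continuous_map_compose)
      then have *: "path_component_of X (s (g a)) (s (g t))"
        unfolding path_component_of_def
        by (rule_tac x = "s \<circ> (g \<circ> h)" in exI) (auto simp: h_def)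
      have "s (g a) \<in> topspace X" "s (g t) \<in> topspace X" "f (s (g a)) = g a" "f (s (g t)) = g t"
        using U gY[OF a] gY[OF t(1)] e(2)[OF t] by (auto simp: continuous_map_def)
      then show "path_component_of X z z'"
        using z fib * by (metis path_component_of_trans)
    qed
    then show "\<exists>T. openin (top_of_set {0..1}) T \<and> a \<in> T \<and> (\<forall>t\<in>T. R a t)"
      using a e(1) by (intro exI[of _ "{0..1} \<inter> ball a e"]) (auto simp: dist_commute)
  qed auto
  then show ?thesis
    using x x' g0 g1 unfolding R_def by metis
qed

text \<open>Surjectivity on components comes from surjectivity of \<open>f\<close>; injectivity is
  \<open>path_component_of_fibres\<close>.\<close>

lemma bij_betw_pi0_map:
  assumes f: "continuous_map X Y f"
    and surj: "\<And>y. y \<in> topspace Y \<Longrightarrow> \<exists>x\<in>topspace X. f x = y"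
    and fib: "\<And>x x'. \<lbrakk>x \<in> topspace X; x' \<in> topspace X; f x = f x'\<rbrakk> \<Longrightarrow> path_component_of X x x'"
    and sec: "\<And>y. y \<in> topspace Y \<Longrightarrow> \<exists>U s. openin Y U \<and> y \<in> U \<and>
                 continuous_map (subtopology Y U) X s \<and> (\<forall>z\<in>U. f (s z) = z)"
  shows "bij_betw (pi0_map Y f) (path_components_of X) (path_components_of Y)"
proof -
  have fY: "f x \<in> topspace Y" if "x \<in> topspace X" for x
    using f that by (auto simp: continuous_map_def)
  have eq: "pi0_map Y f (path_component_of_set X x) = path_component_of_set Y (f x)"
    if "x \<in> topspace X" for x
    by (rule pi0_map_eq[OF f])
      (use that in \<open>auto simp: path_component_in_path_components_of path_component_of_refl\<close>)
  show ?thesis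
    unfolding bij_betw_def
  proof
    show "inj_on (pi0_map Y f) (path_components_of X)"
    proof (rule inj_onI)
      fix C D assume "C \<in> path_components_of X" "D \<in> path_components_of X"
        and CD: "pi0_map Y f C = pi0_map Y f D"
      then obtain x x' where x: "x \<in> topspace X" "C = path_component_of_set X x"
        and x': "x' \<in> topspace X" "D = path_component_of_set X x'"
        unfolding path_components_of_def by blast
      then have "path_component_of_set Y (f x) = path_component_of_set Y (f x')"
        using CD eq by simp
      then have "path_component_of Y (f x) (f x')"
        using fY x x' by (metis mem_Collect_eq path_component_of_refl)
      then have "path_component_of X x x'"
        using path_component_of_fibres[OF fib sec x(1) x'(1)] by blast
      then show "C = D"
        using x x' by (metis path_component_of_equiv)
    qed
    show "pi0_map Y f ` path_components_of X = path_components_of Y"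
    proof (intro subset_antisym subsetI)
      fix D assume "D \<in> pi0_map Y f ` path_components_of X"
      then show "D \<in> path_components_of Y"
        using eq fY unfolding path_components_of_def by auto
    next
      fix D assume "D \<in> path_components_of Y"
      then obtain y where y: "y \<in> topspace Y" "D = path_component_of_set Y y"
        unfolding path_components_of_def by blast
      then obtain x where "x \<in> topspace X" "f x = y" using surj by blast
      then show "D \<in> pi0_map Y f ` path_components_of X"
        using eq y unfolding path_components_of_def by (metis imageI)
    qed
  qed
qed

section \<open>The topology of the Grassmannian, seen through frames\<close>

lemma quotient_map_span:
  "quotient_map (frame_space j) (grassmannian_topology j :: 'a::euclidean_space set topology)
     (\<lambda>v. span (v ` {..<j}))"
  unfolding quotient_map_def
proof (intro conjI allI impI)
  have "W \<in> (\<lambda>v. span (v ` {..<j})) ` topspace (frame_space j)"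
    if "W \<in> topspace (grassmannian_topology j)" for W :: "'a set"
  proof -
    from that have W: "subspace W" "dim W = j"
      by (auto simp: topspace_grassmannian grassmannian_def)
    obtain B where B: "B \<subseteq> W" "independent B" "W \<subseteq> span B" "card B = dim W"
      using basis_exists by blast
    then have "finite B" by (simp add: independent_imp_finite)
    then obtain h where h: "bij_betw h {..<j} B"
      using B W ex_bij_betw_nat_finite[of B] by (auto simp: atLeast0LessThan)
    \<comment> \<open>Points of a product topology are extensional, so the enumeration is cut off
      outside \<open>{..<j}\<close>.\<close>
    define v where "v = restrict h {..<j}"
    have v: "v ` {..<j} = B" "inj_on v {..<j}"
      using h by (auto simp: v_def bij_betw_def inj_on_def)
    then have "v \<in> topspace (frame_space j)"
      using B by (auto simp: frame_space_def v_def)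
    moreover have "span (v ` {..<j}) = W"
      using v B W by (simp add: span_subspace)
    ultimately show ?thesis by blast
  qed
  then show "(\<lambda>v. span (v ` {..<j})) ` topspace (frame_space j) =
      topspace (grassmannian_topology j :: 'a set topology)"
    using span_frame_in_grassmannian topspace_grassmannian by blast
next
  fix U :: "'a set set" assume "U \<subseteq> topspace (grassmannian_topology j)"
  then show "openin (frame_space j) {x \<in> topspace (frame_space j). span (x ` {..<j}) \<in> U} =
      openin (grassmannian_topology j) U"
    by (simp add: openin_grassmannian topspace_grassmannian)
qed

text \<open>The source of all continuity into the Grassmannian below: it suffices to choose a frame
  continuously.\<close>

lemma continuous_map_span:
  fixes v :: "nat \<Rightarrow> 'b \<Rightarrow> 'a::euclidean_space"
  assumes c: "\<And>i. i < j \<Longrightarrow> continuous_map Z euclidean (v i)"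
    and ind: "\<And>z. z \<in> topspace Z \<Longrightarrow> inj_on (\<lambda>i. v i z) {..<j} \<and> independent ((\<lambda>i. v i z) ` {..<j})"
  shows "continuous_map Z (grassmannian_topology j) (\<lambda>z. span ((\<lambda>i. v i z) ` {..<j}))"
proof -
  have "continuous_map Z (frame_space j) (\<lambda>z. \<lambda>i\<in>{..<j}. v i z)"
    unfolding frame_space_def
  proof (intro continuous_map_into_subtopology)
    show "continuous_map Z (product_topology (\<lambda>_. euclidean) {..<j}) (\<lambda>z. \<lambda>i\<in>{..<j}. v i z)"
      unfolding continuous_map_componentwise using c by auto
    show "(\<lambda>z. \<lambda>i\<in>{..<j}. v i z) \<in> topspace Z \<rightarrow> {v. inj_on v {..<j} \<and> independent (v ` {..<j})}"
      using ind by (auto simp: inj_on_def)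
  qed
  from continuous_map_compose[OF this quotient_imp_continuous_map[OF quotient_map_span]]
  show ?thesis by (simp add: o_def)
qed

text \<open>The projection onto \<open>W\<close> along \<open>C\<close>, meaningful when the two are
  complementary. \<open>C\<close> comes first because it stays fixed while \<open>W\<close>
  varies.\<close>

definition oblique_proj :: "'a::real_vector set \<Rightarrow> 'a set \<Rightarrow> 'a \<Rightarrow> 'a" where
  "oblique_proj C W x = (THE w. w \<in> W \<and> x - w \<in> C)"

lemma oblique_proj_eq:
  assumes "subspace W" "subspace C" "W \<inter> C = {0}" "w \<in> W" "x - w \<in> C"
  shows "oblique_proj C W x = w"
  unfolding oblique_proj_def
proof (rule the_equality)
  fix w' assume w': "w' \<in> W \<and> x - w' \<in> C"
  then have "w' - w \<in> W" using assms by (simp add: subspace_diff)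
  moreover have "w' - w \<in> C" using subspace_diff[OF assms(2,5), of "x - w'"] w' by simp
  ultimately have "w' - w \<in> W \<inter> C" by blast
  then show "w' = w" using assms(3) by simp
qed (use assms in auto)

lemma tendsto_det:
  fixes M :: "'b \<Rightarrow> real ^ 'n ^ 'n"
  assumes "\<And>i j. ((\<lambda>z. M z $ i $ j) \<longlongrightarrow> L $ i $ j) F"
  shows "((\<lambda>z. det (M z)) \<longlongrightarrow> det L) F"
  unfolding det_def by (intro tendsto_sum tendsto_mult tendsto_const tendsto_prod assms)

text \<open>On frames \<open>v\<close>, the projection is computed by Cramer's rule in the basis formed by
  \<open>v\<close> and a fixed basis of \<open>C\<close>; the determinant also shows that the domain is open.\<close>

lemma continuous_map_oblique_proj:
  fixes C :: "(real ^ 'n) set"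
  assumes C: "subspace C" and dC: "dim C + k = CARD('n)"
  shows "continuous_map (subtopology (grassmannian_topology k) {W \<in> grassmannian k. W \<inter> C = {0}})
           euclidean (\<lambda>W. oblique_proj C W x)"
    and "\<lbrakk>W \<in> grassmannian k; W \<inter> C = {0}\<rbrakk> \<Longrightarrow>
           oblique_proj C W x \<in> W \<and> x - oblique_proj C W x \<in> C"
proof -
  obtain \<phi> where \<phi>: "bij_betw \<phi> (UNIV :: 'n set) {..<CARD('n)}"
    using ex_bij_betw_finite_nat[of "UNIV :: 'n set"] by (auto simp: atLeast0LessThan)
  obtain B where B: "B \<subseteq> C" "independent B" "C \<subseteq> span B" "card B = dim C"
    using basis_exists by blast
  then have "finite B" by (simp add: independent_imp_finite)
  then obtain h where h: "bij_betw h {k..<CARD('n)} B"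
    using finite_same_card_bij[of "{k..<CARD('n)}" B] B(4) dC by (metis add_diff_cancel_right' card_atLeastLessThan finite_atLeastLessThan)
  have spB: "span B = C" using B C by (simp add: span_subspace)
  \<comment> \<open>The numbering \<phi> of the index type lets the frame supply the columns
    numbered below \<open>k\<close> and the basis of \<open>C\<close> the others.\<close>
  define cl where "cl v c = (if \<phi> c < k then v (\<phi> c) else h (\<phi> c))" for v :: "nat \<Rightarrow> real ^ 'n" and c
  define A where "A v = (\<chi> r c. cl v c $ r)" for v
  have colA: "column c (A v) = cl v c" for c v
    by (simp add: A_def column_def vec_eq_iff)
  have kn: "k \<le> CARD('n)" using dC by simp
  have im: "\<phi> ` {c. Q (\<phi> c)} = {m. m < CARD('n) \<and> Q m}" for Q
  proof -
    have "\<phi> ` {c. Q (\<phi> c)} = range \<phi> \<inter> {m. Q m}" by auto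
    then show ?thesis using \<phi> by (auto simp: bij_betw_def)
  qed
  have im1: "\<phi> ` {c. \<phi> c < k} = {..<k}"
    using im[of "\<lambda>m. m < k"] kn by auto
  have im2: "\<phi> ` {c. \<not> \<phi> c < k} = {k..<CARD('n)}"
    using im[of "\<lambda>m. \<not> m < k"] by auto
  have "cl v ` UNIV = v ` \<phi> ` {c. \<phi> c < k} \<union> h ` \<phi> ` {c. \<not> \<phi> c < k}" for v
  proof -
    have "cl v ` UNIV = cl v ` {c. \<phi> c < k} \<union> cl v ` {c. \<not> \<phi> c < k}"
      unfolding image_Un[symmetric] by (rule arg_cong[where f = "image (cl v)"]) blast
    then show ?thesis by (simp add: cl_def image_image)
  qed
  then have cols: "columns (A v) = v ` {..<k} \<union> B" for v
    using h by (simp add: columns_def colA bij_betw_def im1 im2 flip: full_SetCompr_eq)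
  have spcols: "span (columns (A v)) = {a + c |a c. a \<in> span (v ` {..<k}) \<and> c \<in> C}" for v
    unfolding cols span_Un spB ..
  have det: "det (A v) \<noteq> 0 \<longleftrightarrow> span (v ` {..<k}) \<inter> C = {0}"
    if v: "v \<in> topspace (frame_space k)" for v
  proof -
    have dv: "dim (span (v ` {..<k})) = k"
      using span_frame_in_grassmannian[OF v] by (simp add: grassmannian_def)
    have "det (A v) \<noteq> 0 \<longleftrightarrow> span (columns (A v)) = UNIV"
      by (metis invertible_det_nz invertible_right_inverse matrix_right_invertible_span_columns span_vec_eq)
    \<comment> \<open>The dimensions of the span and of \<open>C\<close> add up to
      \<open>CARD('n)\<close>, so filling the space amounts to meeting trivially.\<close>
    also have "\<dots> \<longleftrightarrow> dim {a + c |a c. a \<in> span (v ` {..<k}) \<and> c \<in> C} = CARD('n)"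
      unfolding spcols[symmetric] by (metis DIM_cart DIM_real dim_eq_full dim_span mult.right_neutral span_span)
    also have "\<dots> \<longleftrightarrow> dim (span (v ` {..<k}) \<inter> C) = 0"
      using dim_sums_Int[OF subspace_span[of "v ` {..<k}"] C] dv dC by arith
    also have "\<dots> \<longleftrightarrow> span (v ` {..<k}) \<inter> C = {0}"
      using span_0 subspace_0[OF C] by auto
    finally show ?thesis .
  qed
  \<comment> \<open>By Cramer's rule these are the coordinates of \<open>x\<close> in the columns of
    \<open>A v\<close>; \<open>P v\<close> keeps the part along the frame.\<close>
  define y where "y v = (\<chi> c. det (\<chi> i j. if j = c then x $ i else A v $ i $ j) / det (A v))" for v
  define P where "P v = (\<Sum>c | \<phi> c < k. y v $ c *\<^sub>R v (\<phi> c))" for v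
  have P: "P v \<in> span (v ` {..<k}) \<and> x - P v \<in> C" if "det (A v) \<noteq> 0" for v
  proof -
    have "A v *v y v = x"
      using cramer[OF that] unfolding y_def by blast
    then have "x = (\<Sum>c\<in>UNIV. y v $ c *\<^sub>R cl v c)"
      by (simp add: matrix_mult_sum colA scalar_mult_eq_scaleR)
    also have "\<dots> = (\<Sum>c | \<phi> c < k. y v $ c *\<^sub>R cl v c) + (\<Sum>c | \<not> \<phi> c < k. y v $ c *\<^sub>R cl v c)"
      by (subst sum.union_disjoint[symmetric]) (auto intro: sum.cong)
    also have "(\<Sum>c | \<phi> c < k. y v $ c *\<^sub>R cl v c) = P v"
      unfolding P_def cl_def by simp
    finally have "x - P v = (\<Sum>c | \<not> \<phi> c < k. y v $ c *\<^sub>R cl v c)" by simp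
    moreover have "\<dots> \<in> C"
    proof (intro subspace_sum[OF C] subspace_scale[OF C])
      fix c assume "c \<in> {c. \<not> \<phi> c < k}"
      then have "cl v c \<in> h ` \<phi> ` {c. \<not> \<phi> c < k}" by (auto simp: cl_def)
      then show "cl v c \<in> C" unfolding im2 using h B(1) by (auto simp: bij_betw_def)
    qed
    moreover have "P v \<in> span (v ` {..<k})"
      unfolding P_def by (intro span_sum span_scale span_base) auto
    ultimately show ?thesis by simp
  qed
  have proj: "oblique_proj C (span (v ` {..<k})) x = P v" and
    projP: "P v \<in> span (v ` {..<k}) \<and> x - P v \<in> C"
    if "v \<in> topspace (frame_space k)" "span (v ` {..<k}) \<inter> C = {0}" for v
    using that P[of v] det[of v] oblique_proj_eq[OF subspace_span C] by blast+
  show "oblique_proj C W x \<in> W \<and> x - oblique_proj C W x \<in> C"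
    if W: "W \<in> grassmannian k" "W \<inter> C = {0}"
  proof -
    obtain v where "v \<in> topspace (frame_space k)" "W = span (v ` {..<k})"
      using quotient_imp_surjective_map[OF quotient_map_span] W(1)
      unfolding topspace_grassmannian by blast
    then show ?thesis using proj projP W(2) by simp
  qed
  have lim_v: "((\<lambda>v. v i) \<longlongrightarrow> v i) (atin (frame_space k) v)"
    if "i < k" "v \<in> topspace (frame_space k)" for i and v :: "nat \<Rightarrow> real ^ 'n"
  proof -
    have "continuous_map (frame_space k) euclidean (\<lambda>v :: nat \<Rightarrow> real ^ 'n. v i)"
      unfolding frame_space_def using that(1)
      by (intro continuous_map_from_subtopology continuous_map_product_projection) auto
    then show ?thesis using that(2) by (simp add: continuous_map_atin)
  qed
  have lim_A: "((\<lambda>v. A v $ i $ j) \<longlongrightarrow> A v $ i $ j) (atin (frame_space k) v)"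
    if v: "v \<in> topspace (frame_space k)" for i j v
    using lim_v[OF _ v] by (auto simp: A_def cl_def intro!: tendsto_intros)
  have lim_det: "((\<lambda>v. det (A v)) \<longlongrightarrow> det (A v)) (atin (frame_space k) v)"
    if v: "v \<in> topspace (frame_space k)" for v
    using lim_A[OF v] by (rule tendsto_det)
  define U where "U = {W \<in> grassmannian k. W \<inter> C = {0}}"
  define V where "V = {v \<in> topspace (frame_space k). span (v ` {..<k}) \<in> U}"
  have Veq: "V = {v \<in> topspace (frame_space k). det (A v) \<noteq> 0}"
    using det span_frame_in_grassmannian by (auto simp: V_def U_def)
  have "continuous_map (frame_space k) euclideanreal (\<lambda>v. det (A v))"
    using lim_det by (simp add: continuous_map_atin)
  from openin_continuous_map_preimage[OF this, of "- {0}"]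
  have oV: "openin (frame_space k) V" by (simp add: Veq open_Compl)
  then have oU: "openin (grassmannian_topology k) U"
    by (auto simp: openin_grassmannian V_def U_def)
  have "continuous_map (subtopology (frame_space k) V) euclidean P"
    unfolding continuous_map_atin limitin_canonical_iff
  proof
    fix v assume "v \<in> topspace (subtopology (frame_space k) V)"
    then have v: "v \<in> topspace (frame_space k)" "v \<in> V" "det (A v) \<noteq> 0" by (auto simp: Veq)
    have "((\<lambda>v. y v $ c) \<longlongrightarrow> y v $ c) (atin (frame_space k) v)" for c
      unfolding y_def vec_lambda_beta
    proof (intro tendsto_divide lim_det v(1,3) tendsto_det)
      show "((\<lambda>v. (\<chi> i j. if j = c then x $ i else A v $ i $ j) $ i $ j) \<longlongrightarrow>
          (\<chi> i j. if j = c then x $ i else A v $ i $ j) $ i $ j) (atin (frame_space k) v)" for i j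
        using lim_A[OF v(1)] by (cases "j = c") auto
    qed
    then have "(P \<longlongrightarrow> P v) (atin (frame_space k) v)"
      unfolding P_def using lim_v[OF _ v(1)] by (intro tendsto_sum tendsto_scaleR) auto
    then show "(P \<longlongrightarrow> P v) (atin (subtopology (frame_space k) V) v)"
      unfolding atin_subtopology_within[OF v(2)]
      by (rule tendsto_mono[rotated]) (unfold atin_within_def, intro inf_mono, auto)
  qed
  moreover have "P v = ((\<lambda>W. oblique_proj C W x) \<circ> (\<lambda>v. span (v ` {..<k}))) v"
    if "v \<in> topspace (subtopology (frame_space k) V)" for v
    using that proj by (auto simp: V_def U_def)
  ultimately have cP: "continuous_map (subtopology (frame_space k) V) euclidean
      ((\<lambda>W. oblique_proj C W x) \<circ> (\<lambda>v. span (v ` {..<k})))"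
    by (rule continuous_map_eq)
  \<comment> \<open>\<open>V\<close> is the full preimage of the open set \<open>U\<close>, so the
    restricted map is still a quotient map and continuity on frames descends.\<close>
  have "quotient_map (subtopology (frame_space k) V) (subtopology (grassmannian_topology k) U)
      (\<lambda>v. span (v ` {..<k}))"
    using oU by (intro quotient_map_restriction quotient_map_span) (auto simp: V_def)
  from continuous_compose_quotient_map[OF this cP]
  show "continuous_map (subtopology (grassmannian_topology k) {W \<in> grassmannian k. W \<inter> C = {0}})
           euclidean (\<lambda>W. oblique_proj C W x)"
    unfolding U_def .
qed

section \<open>Nondegenerate symmetric forms\<close>

text \<open>Two points are joined by two segments through a third point \<open>w3\<close> near the
  first. A segment from \<open>w\<close> to a point outside \<open>span (insert w Z)\<close> misses
  \<open>Z\<close>, and the codimension makes these spans proper in \<open>E\<close>. The second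
  claim gives nonemptiness, also when \<open>e\<close> lies in \<open>Z\<close>.\<close>

lemma path_connected_halfspace_diff:
  fixes E Z :: "'a::euclidean_space set"
  assumes E: "subspace E" and Z: "subspace Z" and dim: "dim Z + 2 \<le> dim E" and \<phi>: "linear \<phi>"
  shows "path_connected {w \<in> E. w \<notin> Z \<and> \<phi> w > (0::real)}"
    and "\<lbrakk>e \<in> E; \<phi> e > 0\<rbrakk> \<Longrightarrow> \<exists>w\<in>E. w \<notin> Z \<and> \<phi> w > 0"
proof -
  note \<phi>s = linear_add[OF \<phi>] linear_scale[OF \<phi>]
  have ex: "\<exists>x\<in>E. x \<notin> T" if "dim T < dim E" for T
    using dim_subset[of E T] that by (meson leD subsetI)
  have small: "\<exists>r>0. \<forall>s. 0 < s \<and> s \<le> r \<longrightarrow> \<phi> (e + s *\<^sub>R x) > 0" if e: "\<phi> e > 0" for e x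
  proof -
    \<comment> \<open>Chosen so that the perturbation changes \<phi> by at most half of
      \<open>\<phi> e\<close>; the summand 1 avoids division by zero.\<close>
    define r where "r = \<phi> e / (2 * (\<bar>\<phi> x\<bar> + 1))"
    have "r > 0" using e by (simp add: r_def)
    moreover have "\<phi> (e + s *\<^sub>R x) > 0" if s: "0 < s" "s \<le> r" for s
    proof -
      have "s * \<bar>\<phi> x\<bar> \<le> r * (\<bar>\<phi> x\<bar> + 1)" using s by (intro mult_mono) auto
      also have "\<dots> = \<phi> e / 2" by (simp add: r_def field_simps)
      finally have "\<bar>s * \<phi> x\<bar> \<le> \<phi> e / 2" using s by (simp add: abs_mult)
      then show ?thesis using e by (simp add: \<phi>s abs_le_iff)
    qed
    ultimately show ?thesis by blast
  qed
  show "\<exists>w\<in>E. w \<notin> Z \<and> \<phi> w > 0" if e: "e \<in> E" "\<phi> e > 0"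
  proof (cases "e \<in> Z")
    case True
    obtain x where x: "x \<in> E" "x \<notin> Z" using ex[of Z] dim by auto
    obtain r where r: "r > 0" "\<phi> (e + r *\<^sub>R x) > 0" using small[OF e(2)] by blast
    have "e + r *\<^sub>R x \<notin> Z"
    proof
      assume "e + r *\<^sub>R x \<in> Z"
      then have "r *\<^sub>R x \<in> Z" using subspace_diff[OF Z _ True] by fastforce
      then show False using x r subspace_scale[OF Z, of "r *\<^sub>R x" "inverse r"] by simp
    qed
    then show ?thesis using r x e E by (auto simp: subspace_add subspace_scale)
  qed (use e in auto)
  define S where "S = {w \<in> E. w \<notin> Z \<and> \<phi> w > 0}"
  have seg: "closed_segment w w' \<subseteq> S" if w: "w \<in> S" "w' \<in> S" "w' \<notin> span (insert w Z)" for w w'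
  proof
    fix v assume "v \<in> closed_segment w w'"
    then obtain s where s: "0 \<le> s" "s \<le> 1" "v = (1 - s) *\<^sub>R w + s *\<^sub>R w'"
      unfolding closed_segment_def by blast
    have "v \<in> E" using w E s by (auto simp: S_def subspace_add subspace_scale)
    moreover have "v \<notin> Z"
    proof
      assume vZ: "v \<in> Z"
      show False
      proof (cases "s = 0")
        case True
        then show False using vZ s w by (simp add: S_def)
      next
        case False
        have "v - (1 - s) *\<^sub>R w \<in> span (insert w Z)"
          using vZ by (intro span_diff span_scale span_base) auto
        then have "s *\<^sub>R w' \<in> span (insert w Z)" using s(3) by simp
        then have "w' \<in> span (insert w Z)"
          using False span_scale[of "s *\<^sub>R w'" _ "inverse s"] by simp
        then show False using w by simp
      qed
    qed
    moreover have "\<phi> v > 0"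
    proof (cases "s = 0")
      case False
      then have "s * \<phi> w' > 0" using w s by (simp add: S_def)
      moreover have "(1 - s) * \<phi> w \<ge> 0" using w s by (simp add: S_def)
      ultimately show ?thesis using s(3) by (simp add: \<phi>s)
    qed (use s w in \<open>simp add: S_def\<close>)
    ultimately show "v \<in> S" by (simp add: S_def)
  qed
  show "path_connected {w \<in> E. w \<notin> Z \<and> \<phi> w > 0}"
    unfolding S_def[symmetric] path_connected_component
  proof (intro ballI)
    fix w1 w2 assume w: "w1 \<in> S" "w2 \<in> S"
    define T where "T w = span (insert w Z)" for w
    have T: "subspace (T w)" "Z \<subseteq> T w" "w \<in> T w" for w
      by (auto simp: T_def span_base)
    have dT: "dim (T w) < dim E" for w
      using dim by (simp add: T_def dim_insert)
    obtain x1 where x1: "x1 \<in> E" "x1 \<notin> T w1" using ex dT by blast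
    obtain x2 where x2: "x2 \<in> E" "x2 \<notin> T w2" using ex dT by blast
    \<comment> \<open>A vector space is not the union of two proper subspaces: if each of
      \<open>x1\<close>, \<open>x2\<close> lies in the other subspace, their sum lies in
      neither.\<close>
    have "\<exists>x\<in>E. x \<notin> T w1 \<and> x \<notin> T w2"
    proof (cases "x1 \<in> T w2 \<and> x2 \<in> T w1")
      case True
      then have "x1 + x2 \<notin> T w1" "x1 + x2 \<notin> T w2"
        using x1 x2 T(1) by (metis add_diff_cancel_right' subspace_diff, metis add_diff_cancel_left' subspace_diff)
      then show ?thesis using x1 x2 E by (meson subspace_add)
    qed (use x1 x2 in blast)
    then obtain x where x: "x \<in> E" "x \<notin> T w1" "x \<notin> T w2" by blast
    obtain r where r: "r > 0" "\<And>s. 0 < s \<Longrightarrow> s \<le> r \<Longrightarrow> \<phi> (w1 + s *\<^sub>R x) > 0"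
      using small[of w1 x] w(1) by (auto simp: S_def)
    have n1: "w1 + s *\<^sub>R x \<notin> T w1" if "s \<noteq> 0" for s
    proof
      assume "w1 + s *\<^sub>R x \<in> T w1"
      then have "inverse s *\<^sub>R (w1 + s *\<^sub>R x - w1) \<in> T w1"
        using T by (meson subspace_diff subspace_scale)
      then show False using that x by simp
    qed
    \<comment> \<open>The direction \<open>x\<close> is not in \<open>T w2\<close>, so the line
      through \<open>w1\<close> meets \<open>T w2\<close> at most once; one of the parameters
      \<open>r\<close> and \<open>r / 2\<close> avoids it.\<close>
    have n2: "w1 + r *\<^sub>R x \<notin> T w2 \<or> w1 + (r / 2) *\<^sub>R x \<notin> T w2"
    proof (rule ccontr)
      assume "\<not> ?thesis"
      then have "(w1 + r *\<^sub>R x) - (w1 + (r / 2) *\<^sub>R x) \<in> T w2"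
        using T subspace_diff by blast
      moreover have "(w1 + r *\<^sub>R x) - (w1 + (r / 2) *\<^sub>R x) = (r / 2) *\<^sub>R x"
        by (simp add: algebra_simps flip: scaleR_add_left)
      ultimately have "inverse (r / 2) *\<^sub>R (r / 2) *\<^sub>R x \<in> T w2"
        using T subspace_scale by metis
      then show False using r x by simp
    qed
    have "\<exists>s. 0 < s \<and> s \<le> r \<and> w1 + s *\<^sub>R x \<notin> T w2"
      using n2 r(1) by (metis half_gt_zero less_imp_le order_refl field_sum_of_halves less_add_same_cancel1)
    then obtain s where s: "0 < s" "s \<le> r" "w1 + s *\<^sub>R x \<notin> T w2" by blast
    define w3 where "w3 = w1 + s *\<^sub>R x"
    have w3: "w3 \<notin> T w1" "w3 \<notin> T w2" using s n1 by (auto simp: w3_def)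
    have "w3 \<in> S"
      using w3 T(2) w(1) x(1) r(2)[OF s(1,2)] E by (auto simp: S_def w3_def subspace_add subspace_scale)
    then have "closed_segment w1 w3 \<subseteq> S" "closed_segment w2 w3 \<subseteq> S"
      using seg w w3 unfolding T_def by blast+
    then have "path_component S w1 w3" "path_component S w2 w3"
      unfolding path_component_def by (metis path_linepath path_image_linepath pathstart_linepath pathfinish_linepath)+
    then show "path_component S w1 w2"
      by (metis path_component_sym path_component_trans)
  qed
qed

section \<open>Linear algebra of a nondegenerate symmetric form\<close>

locale nondegenerate_symmetric =
  fixes b :: "'a::euclidean_space \<Rightarrow> 'a \<Rightarrow> real"
  assumes symf: "symmetric_form b" and nondegf: "nondegenerate_form b"
begin

lemma b_bilinear: "bilinear b" and b_sym: "b x y = b y x"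
  using symf by (auto simp: symmetric_form_def)

lemmas b_simps = bilinear_ladd[OF b_bilinear] bilinear_radd[OF b_bilinear]
  bilinear_lsub[OF b_bilinear] bilinear_rsub[OF b_bilinear]
  bilinear_lmul[OF b_bilinear] bilinear_rmul[OF b_bilinear]
  bilinear_lzero[OF b_bilinear] bilinear_rzero[OF b_bilinear]
  bilinear_lneg[OF b_bilinear] bilinear_rneg[OF b_bilinear]

lemma b_linear: "linear (b x)" and b_linear': "linear (\<lambda>x. b x y)"
  using b_bilinear by (auto simp: bilinear_def)

lemma tendsto_form [tendsto_intros]:
  "(f \<longlongrightarrow> l) F \<Longrightarrow> (g \<longlongrightarrow> m) F \<Longrightarrow> ((\<lambda>z. b (f z) (g z)) \<longlongrightarrow> b l m) F"
  using bounded_bilinear.tendsto[OF bilinear_conv_bounded_bilinear[THEN iffD1, OF b_bilinear]] .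

text \<open>Writing the form as the inner product twisted by an invertible \<open>J\<close>
  transfers facts on Euclidean orthogonality to \<open>b\<close>. The vector \<open>J x\<close> is
  the Riesz vector of the functional \<open>b x\<close>.\<close>

lemma representation:
  obtains J where "linear J" "inj J" "surj J" "\<And>x y. b x y = J x \<bullet> y"
proof -
  define J where "J x = adjoint (b x) (1::real)" for x
  have J: "b x y = J x \<bullet> y" for x y
    by (simp add: J_def adjoint_clauses[OF b_linear])
  have "linear J"
  proof (rule linearI)
    show "J (x + y) = J x + J y" for x y
      by (rule vector_eq_rdot[THEN iffD1]) (simp add: inner_add_left b_simps flip: J)
    show "J (r *\<^sub>R x) = r *\<^sub>R J x" for r x
      by (rule vector_eq_rdot[THEN iffD1]) (simp add: b_simps flip: J)
  qed
  moreover have "inj J"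
    unfolding linear_injective_0[OF \<open>linear J\<close>]
  proof (intro allI impI)
    fix x assume "J x = 0"
    then have "\<forall>y. b x y = 0" by (simp add: J)
    then show "x = 0" using nondegf by (simp add: nondegenerate_form_def)
  qed
  ultimately show ?thesis using that J linear_injective_imp_surjective by blast
qed

lemma subspace_orth_compl: "subspace (orth_compl b W)"
  by (auto simp: subspace_def orth_compl_def b_simps)

lemma orth_compl_span: "orth_compl b (span W) = orth_compl b W"
proof -
  have "b x w = 0" if "x \<in> orth_compl b W" "w \<in> span W" for x w
    using that(2)
    by (rule linear_eq_0_on_span[OF b_linear, rotated]) (use that(1) in \<open>simp add: orth_compl_def\<close>)
  then show ?thesis by (auto simp: orth_compl_def span_base)
qed

lemma orth_compl_anti: "V \<subseteq> W \<Longrightarrow> orth_compl b W \<subseteq> orth_compl b V"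
  by (auto simp: orth_compl_def)

lemma dim_orth_compl:
  assumes "subspace W" shows "dim (orth_compl b W) + dim W = DIM('a)"
proof -
  obtain J where J: "linear J" "inj J" "surj J" "\<And>x y. b x y = J x \<bullet> y"
    using representation by blast
  have "J ` orth_compl b W = {y \<in> UNIV. \<forall>x\<in>W. orthogonal x y}"
  proof (intro subset_antisym subsetI)
    fix y assume "y \<in> {y \<in> UNIV. \<forall>x\<in>W. orthogonal x y}"
    moreover obtain x where "y = J x" using J(3) by blast
    ultimately show "y \<in> J ` orth_compl b W"
      by (auto simp: orth_compl_def J(4) orthogonal_def inner_commute)
  qed (auto simp: orth_compl_def J(4) orthogonal_def inner_commute)
  moreover have "dim (J ` orth_compl b W) = dim (orth_compl b W)"
    using J by (intro dim_image_eq) (auto intro: inj_on_subset)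
  ultimately show ?thesis
    using dim_subspace_orthogonal_to_vectors[OF assms subspace_UNIV] by simp
qed

lemma orth_compl_orth_compl:
  assumes "subspace W" shows "orth_compl b (orth_compl b W) = W"
proof (rule subspace_dim_equal[symmetric])
  show "W \<subseteq> orth_compl b (orth_compl b W)" by (auto simp: orth_compl_def b_sym)
  show "dim (orth_compl b (orth_compl b W)) \<le> dim W"
    using dim_orth_compl[OF assms] dim_orth_compl[OF subspace_orth_compl[of W]] by simp
qed (use assms subspace_orth_compl in auto)

text \<open>A dimension count: for subspaces of equal dimension, trivial intersection already gives
  transversality.\<close>

lemma sum_orth_compl:
  assumes "subspace W" "subspace F" "dim W = dim F" "W \<inter> orth_compl b F = {0}"
  shows "{x + y |x y. x \<in> W \<and> y \<in> orth_compl b F} = UNIV"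
proof -
  have "dim {x + y |x y. x \<in> W \<and> y \<in> orth_compl b F} = DIM('a)"
    using dim_sums_Int[OF assms(1) subspace_orth_compl[of F]] dim_orth_compl[OF assms(2)] assms(3,4)
    by simp
  then show ?thesis
    by (intro subspace_dim_equal subspace_sums assms(1) subspace_orth_compl) auto
qed

text \<open>A vector of \<open>F\<close> orthogonal to \<open>W\<close> is orthogonal to
  \<open>W\<close> and to the complement of \<open>F\<close>, which together span everything;
  nondegeneracy kills it.\<close>

lemma transverse_commute:
  assumes "subspace W" "subspace F" "dim W = dim F" "W \<inter> orth_compl b F = {0}"
  shows "F \<inter> orth_compl b W = {0}"
proof -
  have "f = 0" if f: "f \<in> F" "f \<in> orth_compl b W" for f
  proof -
    have "b f z = 0" for z
    proof -
      obtain x y where "z = x + y" "x \<in> W" "y \<in> orth_compl b F"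
        using sum_orth_compl[OF assms] by blast
      then show ?thesis using f b_sym[of f y] by (simp add: b_simps orth_compl_def)
    qed
    then show ?thesis using nondegf by (simp add: nondegenerate_form_def)
  qed
  then show ?thesis using assms(2) subspace_orth_compl by (auto simp: subspace_0)
qed

text \<open>Pairing a vanishing combination with \<open>f j\<close> isolates its coefficient at
  \<open>g j\<close>.\<close>

lemma dual_frame_independent:
  fixes k :: nat
  assumes "\<And>i j. i < k \<Longrightarrow> j < k \<Longrightarrow> b (g i) (f j) = (if i = j then 1 else 0)"
  shows "inj_on g {..<k} \<and> independent (g ` {..<k})"
proof
  show inj: "inj_on g {..<k}"
    by (rule inj_onI) (metis assms lessThan_iff zero_neq_one)
  show "independent (g ` {..<k})"
  proof (rule independent_if_scalars_zero)
    fix c x assume c: "(\<Sum>x\<in>g ` {..<k}. c x *\<^sub>R x) = 0" and "x \<in> g ` {..<k}"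
    then obtain j where j: "j < k" "x = g j" by auto
    have "0 = b (\<Sum>i<k. c (g i) *\<^sub>R g i) (f j)"
      using c by (simp add: sum.reindex[OF inj] b_simps)
    also have "\<dots> = (\<Sum>i<k. c (g i) * b (g i) (f j))"
      by (simp add: linear_sum[OF b_linear'] b_simps)
    also have "\<dots> = (\<Sum>i<k. if i = j then c (g i) else 0)"
      using assms j by (intro sum.cong) auto
    also have "\<dots> = c x" using j by (subst sum.delta) auto
    finally show "c x = 0" by simp
  qed simp
qed

section \<open>Isotropic subspaces and their extension by one vector\<close>

lemma isotropic_orth_compl: "isotropic b W \<longleftrightarrow> W \<subseteq> orth_compl b W"
  by (auto simp: isotropic_def orth_compl_def)

lemma isotropic_span: "isotropic b W \<Longrightarrow> isotropic b (span W)"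
  unfolding isotropic_orth_compl orth_compl_span
  using subspace_orth_compl span_minimal by blast

lemma isotropic_insert:
  "isotropic b (insert u W) \<longleftrightarrow> isotropic b W \<and> b u u = 0 \<and> u \<in> orth_compl b W"
  by (auto simp: isotropic_def orth_compl_def b_sym)

text \<open>Pairing with \<open>l\<close> kills \<open>W\<close> and so detects the coefficient of
  \<open>u\<close>. For a vector orthogonal to \<open>F'\<close> this coefficient vanishes, which
  leaves an element of \<open>W\<close> orthogonal to \<open>F\<close>.\<close>

lemma insert_transverse:
  assumes "W \<inter> orth_compl b F = {0}" "subspace W" "F \<subseteq> F'"
    and "l \<in> F'" "l \<in> orth_compl b W" "b u l \<noteq> 0"
  shows "span (insert u W) \<inter> orth_compl b F' = {0}"
proof -
  have "x = 0" if x: "x \<in> span (insert u W)" "x \<in> orth_compl b F'" for x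
  proof -
    obtain c where "x - c *\<^sub>R u \<in> span W" using x(1) by (auto simp: span_insert)
    then have w: "x - c *\<^sub>R u \<in> W" using assms(2) by (simp add: span_eq_iff[THEN iffD2])
    then have "b (x - c *\<^sub>R u) l = 0" using assms(5) b_sym[of l] by (simp add: orth_compl_def)
    moreover have "b x l = 0" using x assms(4) by (simp add: orth_compl_def)
    ultimately have "c = 0" using assms(6) by (simp add: b_simps)
    then have "x \<in> W \<inter> orth_compl b F" using w x orth_compl_anti[OF assms(3)] by auto
    then show ?thesis using assms(1) by simp
  qed
  then show ?thesis using span_0 subspace_0[OF subspace_orth_compl] by auto
qed

text \<open>The converse: if \<open>b u l = 0\<close>, then \<open>l\<close> is a nonzero vector of
  \<open>F'\<close> orthogonal to the extended space, against
  \<open>transverse_commute\<close>.\<close>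

lemma insert_transverse_imp:
  assumes "span (insert u W) \<inter> orth_compl b F' = {0}" "subspace F'"
    and "dim (span (insert u W)) = dim F'" "l \<in> F'" "l \<in> orth_compl b W" "l \<noteq> 0"
  shows "b u l \<noteq> 0"
proof
  assume "b u l = 0"
  then have "l \<in> orth_compl b (span (insert u W))"
    unfolding orth_compl_span using assms(5) by (auto simp: orth_compl_def b_sym)
  then show False
    using transverse_commute[OF subspace_span assms(2,3,1)] assms(4,6) by auto
qed

text \<open>The form is positive definite on the \<open>p\<close>-dimensional span of the positive
  basis vectors, so an isotropic subspace meets that span trivially.\<close>

lemma isotropic_dim_le:
  assumes sig: "has_signature b p q" and n: "DIM('a) = p + q" and I: "subspace I" "isotropic b I"
  shows "dim I \<le> q"
proof -
  obtain B where B: "independent B" "pairwise (\<lambda>x y. b x y = 0) B" "card {x \<in> B. b x x > 0} = p"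
    using sig unfolding has_signature_def by blast
  define P where "P = {x \<in> B. b x x > 0}"
  have iP: "independent P" "finite P"
    using independent_mono[OF B(1), of P] independent_imp_finite[of P] by (auto simp: P_def)
  have "x = 0" if x: "x \<in> I" "x \<in> span P" for x
  proof -
    obtain c where c: "x = (\<Sum>v\<in>P. c v *\<^sub>R v)"
      using x(2) unfolding span_finite[OF iP(2)] by auto
    have "b x x = (\<Sum>v\<in>P. \<Sum>w\<in>P. c v * c w * b v w)"
      unfolding c by (simp add: linear_sum[OF b_linear] linear_sum[OF b_linear'] b_simps b_sym mult_ac sum_distrib_left)
    also have "\<dots> = (\<Sum>v\<in>P. \<Sum>w\<in>P. if w = v then (c v)\<^sup>2 * b v v else 0)"
      using B(2) by (intro sum.cong refl) (auto simp: pairwise_def P_def power2_eq_square)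
    finally have "(\<Sum>v\<in>P. (c v)\<^sup>2 * b v v) = 0"
      using x(1) I(2) iP(2) by (simp add: isotropic_def)
    moreover have "(c v)\<^sup>2 * b v v \<ge> 0" if "v \<in> P" for v using that by (simp add: P_def)
    ultimately have "\<forall>v\<in>P. (c v)\<^sup>2 * b v v = 0"
      using iP(2) by (simp add: sum_nonneg_eq_0_iff)
    then have "\<forall>v\<in>P. c v = 0" by (auto simp: P_def)
    then show ?thesis using c by simp
  qed
  then have "dim (I \<inter> span P) = 0" by auto
  moreover have "dim {x + y |x y. x \<in> I \<and> y \<in> span P} \<le> DIM('a)" by (rule dim_subset_UNIV)
  moreover have "dim (span P) = p"
    using iP B(3) by (simp add: dim_eq_card_independent P_def)
  ultimately show ?thesis
    using dim_sums_Int[OF I(1) subspace_span[of P]] n by linarith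
qed

text \<open>Orthogonal isotropic vectors of a Lorentzian space are proportional. Otherwise
  \<open>W\<close>, \<open>l\<close> and \<open>u\<close> would span an isotropic space of dimension
  \<open>q + 1\<close>.\<close>

lemma isotropic_orthogonal_imp_span:
  assumes "has_signature b p q" "DIM('a) = p + q" "subspace W" "isotropic b W" "dim W + 1 = q"
    and "l \<in> orth_compl b W" "b l l = 0" "l \<notin> W" "u \<in> orth_compl b W" "b u u = 0" "b u l = 0"
  shows "u \<in> span (insert l W)"
proof (rule ccontr)
  assume u: "u \<notin> span (insert l W)"
  have "isotropic b (insert u (insert l W))"
    using assms by (auto simp: isotropic_insert orth_compl_def)
  from isotropic_dim_le[OF assms(1,2) subspace_span isotropic_span[OF this]]
  have "dim (insert u (insert l W)) \<le> q" by simp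
  moreover have "dim (insert u (insert l W)) = dim W + 2"
    using u assms(3,8) by (simp add: dim_insert span_eq_iff[THEN iffD2])
  ultimately show False using assms(5) by simp
qed

text \<open>The \<open>u\<close> produced here is, up to scale, the isotropic vector on the line \<open>w + \<real> l\<close>.\<close>

definition nullify :: "'a \<Rightarrow> 'a \<Rightarrow> 'a" where
  "nullify l w = (2 * b w l) *\<^sub>R w - b w w *\<^sub>R l"

lemma nullify_isotropic: "b l l = 0 \<Longrightarrow> b (nullify l w) (nullify l w) = 0"
  by (simp add: nullify_def b_simps b_sym[of l w] algebra_simps)

lemma nullify_orth_compl:
  "w \<in> orth_compl b W \<Longrightarrow> l \<in> orth_compl b W \<Longrightarrow> nullify l w \<in> orth_compl b W"
  unfolding nullify_def by (intro subspace_diff subspace_scale subspace_orth_compl)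

text \<open>If \<open>w\<close> is not orthogonal to \<open>l\<close>, neither is the isotropic
  vector made from it.\<close>

lemma b_nullify: "b l l = 0 \<Longrightarrow> b (nullify l w) l = 2 * (b w l)\<^sup>2"
  by (simp add: nullify_def b_simps power2_eq_square)

end

section \<open>Continuous frames\<close>

lemma span_insert_span: "span (insert u (span S)) = span (insert u S)"
  for S :: "'a::real_vector set"
  using span_Un[of "{u}" "span S"] span_Un[of "{u}" S] by (simp only: span_span Un_insert_left Un_empty_left)

lemma span_insert_scale:
  fixes W :: "'a::real_vector set"
  assumes "c \<noteq> 0" shows "span (insert (c *\<^sub>R u) W) = span (insert u W)"
proof (rule subset_antisym; rule span_minimal)
  show "insert (c *\<^sub>R u) W \<subseteq> span (insert u W)"
    by (auto intro: span_base span_scale)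
  have "u = inverse c *\<^sub>R c *\<^sub>R u" using assms by simp
  then have "u \<in> span (insert (c *\<^sub>R u) W)"
    by (metis insertI1 span_base span_scale)
  then show "insert u W \<subseteq> span (insert (c *\<^sub>R u) W)"
    by (auto intro: span_base)
qed auto

lemma grassmannianD: "W \<in> grassmannian k \<Longrightarrow> subspace W" "W \<in> grassmannian k \<Longrightarrow> dim W = k"
  by (auto simp: grassmannian_def)

lemma (in nondegenerate_symmetric) continuous_map_form:
  assumes "continuous_map Z euclidean f" "continuous_map Z euclidean g"
  shows "continuous_map Z euclideanreal (\<lambda>z. b (f z) (g z))"
  using assms by (auto simp: continuous_map_atin intro: tendsto_form)

lemma (in nondegenerate_symmetric) continuous_map_nullify:
  assumes "continuous_map Z euclidean f" "continuous_map Z euclidean g"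
  shows "continuous_map Z euclidean (\<lambda>z. nullify (f z) (g z))"
  using assms unfolding nullify_def continuous_map_atin limitin_canonical_iff
  by (intro ballI tendsto_diff tendsto_scaleR tendsto_mult tendsto_const tendsto_form) auto

text \<open>The type becomes \<open>real ^ 'n\<close> because continuity of oblique projections was
  derived from determinants.\<close>

locale cartesian_form = nondegenerate_symmetric b for b :: "real ^ 'n \<Rightarrow> real ^ 'n \<Rightarrow> real"
begin

text \<open>For \<open>F\<close> of dimension \<open>k\<close> this is an affine chart of the
  Grassmannian: the complements of \<open>F\<^sup>\<bottom>\<close>.\<close>

definition transversal :: "nat \<Rightarrow> (real ^ 'n) set \<Rightarrow> (real ^ 'n) set topology" where
  "transversal k F =
     subtopology (grassmannian_topology k) {W \<in> grassmannian k. W \<inter> orth_compl b F = {0}}"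

lemma topspace_transversal:
  "topspace (transversal k F) = {W \<in> grassmannian k. W \<inter> orth_compl b F = {0}}"
  by (auto simp: transversal_def topspace_grassmannian)

text \<open>On this chart \<open>b\<close> pairs \<open>W\<close> and \<open>F\<close> perfectly, so
  a fixed basis \<open>f\<close> of \<open>F\<close> has a dual basis in \<open>W\<close>. It is
  found by projecting fixed vectors \<open>d i\<close> dual to \<open>f\<close> onto
  \<open>W\<close> along \<open>F\<^sup>\<bottom>\<close>, which preserves pairings with
  \<open>F\<close> and is continuous in \<open>W\<close>.\<close>

lemma dual_frame:
  assumes F: "F \<in> grassmannian k"
  obtains f g where "\<And>i. i < k \<Longrightarrow> f i \<in> F"
    and "\<And>i. i < k \<Longrightarrow> continuous_map (transversal k F) euclidean (g i)"
    and "\<And>W i. \<lbrakk>W \<in> topspace (transversal k F); i < k\<rbrakk> \<Longrightarrow> g i W \<in> W"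
    and "\<And>W i j. \<lbrakk>W \<in> topspace (transversal k F); i < k; j < k\<rbrakk> \<Longrightarrow>
           b (g i W) (f j) = (if i = j then 1 else 0)"
proof -
  obtain f where "f \<in> topspace (frame_space k)" and Ff: "F = span (f ` {..<k})"
    using quotient_imp_surjective_map[OF quotient_map_span, of k] F
    unfolding topspace_grassmannian by blast
  then have f: "inj_on f {..<k}" "independent (f ` {..<k})"
    by (auto simp: frame_space_def)
  obtain J where J: "linear J" "inj J" "surj J" "\<And>x y. b x y = J x \<bullet> y"
    using representation by blast
  have "\<exists>d. \<forall>j<k. b d (f j) = (if i = j then 1 else 0)" for i
  proof -
    obtain L :: "real ^ 'n \<Rightarrow> real" where L: "linear L"
      "\<forall>x\<in>f ` {..<k}. L x = (if x = f i then 1 else 0)"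
      using linear_independent_extend[OF f(2), of "\<lambda>x. if x = f i then 1 else 0"] by blast
    \<comment> \<open>Surjectivity of \<open>J\<close> makes every linear functional a pairing with
      some vector.\<close>
    obtain d where d: "J d = adjoint L 1" using J(3) by (metis surjD)
    have bd: "b d y = L y" for y
      by (simp add: J(4) d adjoint_clauses[OF L(1)])
    show ?thesis
    proof (cases "i < k")
      case True
      then show ?thesis using L(2) f(1) by (intro exI[of _ d]) (auto simp: bd inj_on_def)
    next
      case False
      then show ?thesis by (intro exI[of _ 0]) (auto simp: b_simps)
    qed
  qed
  then obtain d where d: "\<And>i j. j < k \<Longrightarrow> b (d i) (f j) = (if i = j then 1 else 0)"
    by metis
  have dim: "dim (orth_compl b F) + k = CARD('n)"
    using dim_orth_compl[of F] grassmannianD[OF F] by simp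
  note op = continuous_map_oblique_proj[OF subspace_orth_compl dim]
  define g where "g i W = oblique_proj (orth_compl b F) W (d i)" for i W
  have gW: "g i W \<in> W" "d i - g i W \<in> orth_compl b F" if "W \<in> topspace (transversal k F)" for i W
    using op(2)[of W "d i"] that by (auto simp: topspace_transversal g_def)
  have fF: "f j \<in> F" if "j < k" for j using that by (simp add: Ff span_base)
  show ?thesis
  proof (rule that[of f g])
    show "continuous_map (transversal k F) euclidean (g i)" for i
      using op(1) unfolding transversal_def g_def .
    show "b (g i W) (f j) = (if i = j then 1 else 0)"
      if W: "W \<in> topspace (transversal k F)" "i < k" "j < k" for W i j
    proof -
      have "b (d i - g i W) (f j) = 0"
        using gW(2)[OF W(1)] fF[OF W(3)] by (simp add: orth_compl_def)
      then show ?thesis using d[OF W(3), of i] by (simp add: b_simps)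
    qed
  qed (use fF gW in auto)
qed

lemma span_dual_frame:
  assumes "W \<in> grassmannian k" "\<And>i. i < k \<Longrightarrow> g i \<in> W"
    and "\<And>i j. \<lbrakk>i < k; j < k\<rbrakk> \<Longrightarrow> b (g i) (f j) = (if i = j then 1 else 0)"
  shows "span (g ` {..<k}) = W"
proof (rule subspace_dim_equal)
  have "inj_on g {..<k} \<and> independent (g ` {..<k})"
    using assms(3) by (rule dual_frame_independent)
  then have "dim (span (g ` {..<k})) = k"
    by (simp add: dim_eq_card_independent card_image)
  then show "dim W \<le> dim (span (g ` {..<k}))"
    using grassmannianD[OF assms(1)] by simp
  show "span (g ` {..<k}) \<subseteq> W"
    using assms(2) grassmannianD[OF assms(1)] by (intro span_minimal) auto
qed (use grassmannianD[OF assms(1)] in auto)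

text \<open>\<open>Q W\<close> is the projection of \<open>x\<close> to
  \<open>W\<^sup>\<bottom>\<close> along \<open>F\<close>. The dual frame gives an explicit formula,
  hence continuity.\<close>

lemma continuous_orth_proj:
  assumes F: "F \<in> grassmannian k"
  obtains Q where "continuous_map (transversal k F) euclidean Q"
    and "\<And>W. W \<in> topspace (transversal k F) \<Longrightarrow> Q W \<in> orth_compl b W"
    and "\<And>W. W \<in> topspace (transversal k F) \<Longrightarrow> x - Q W \<in> F"
    and "\<And>W. \<lbrakk>W \<in> topspace (transversal k F); x \<in> orth_compl b W\<rbrakk> \<Longrightarrow> Q W = x"
proof -
  obtain f g where f: "\<And>i. i < k \<Longrightarrow> f i \<in> F"
    and cg: "\<And>i. i < k \<Longrightarrow> continuous_map (transversal k F) euclidean (g i)"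
    and gW: "\<And>W i. \<lbrakk>W \<in> topspace (transversal k F); i < k\<rbrakk> \<Longrightarrow> g i W \<in> W"
    and gf: "\<And>W i j. \<lbrakk>W \<in> topspace (transversal k F); i < k; j < k\<rbrakk> \<Longrightarrow>
           b (g i W) (f j) = (if i = j then 1 else 0)"
    using dual_frame[OF F] by blast
  define Q where "Q W = x - (\<Sum>j<k. b x (g j W) *\<^sub>R f j)" for W
  show ?thesis
  proof (rule that[of Q])
    have "((\<lambda>W. b x (g j W)) \<longlongrightarrow> b x (g j W)) (atin (transversal k F) W)"
      if "W \<in> topspace (transversal k F)" "j < k" for W j
      using cg[OF that(2)] that(1) by (intro tendsto_form tendsto_const) (simp add: continuous_map_atin)
    then show "continuous_map (transversal k F) euclidean Q"
      unfolding Q_def continuous_map_atin limitin_canonical_iff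
      by (intro ballI tendsto_diff tendsto_sum tendsto_scaleR tendsto_const) auto
    fix W assume W: "W \<in> topspace (transversal k F)"
    then have "W = span ((\<lambda>i. g i W) ` {..<k})"
      using span_dual_frame[of W k "\<lambda>i. g i W" f] gW[OF W] gf[OF W] by (simp add: topspace_transversal)
    moreover have "b (Q W) (g i W) = 0" if i: "i < k" for i
    proof -
      have "(\<Sum>j<k. b x (g j W) * b (f j) (g i W)) = (\<Sum>j<k. if j = i then b x (g j W) else 0)"
        using gf[OF W] i by (intro sum.cong) (auto simp: b_sym[of "f _"])
      also have "\<dots> = b x (g i W)" using i by (subst sum.delta) auto
      finally show ?thesis by (simp add: Q_def b_simps linear_sum[OF b_linear'])
    qed
    ultimately show "Q W \<in> orth_compl b W"
      using orth_compl_span[of "(\<lambda>i. g i W) ` {..<k}"] by (auto simp: orth_compl_def)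
    show "x - Q W \<in> F"
      using f by (auto simp: Q_def intro!: subspace_sum subspace_scale grassmannianD(1)[OF F])
    show "Q W = x" if "x \<in> orth_compl b W"
      using that gW[OF W] by (simp add: Q_def orth_compl_def)
  qed
qed

text \<open>The dual frame provides a continuous frame of \<open>W z\<close>, and \<open>u z\<close>
  is appended at index \<open>k\<close>.\<close>

lemma continuous_map_span_insert:
  assumes F: "F \<in> grassmannian k"
    and W: "continuous_map Z (transversal k F) W" and u: "continuous_map Z euclidean u"
    and uW: "\<And>z. z \<in> topspace Z \<Longrightarrow> u z \<notin> W z"
  shows "continuous_map Z (grassmannian_topology (Suc k)) (\<lambda>z. span (insert (u z) (W z)))"
proof -
  obtain f g where cg: "\<And>i. i < k \<Longrightarrow> continuous_map (transversal k F) euclidean (g i)"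
    and gW: "\<And>W i. \<lbrakk>W \<in> topspace (transversal k F); i < k\<rbrakk> \<Longrightarrow> g i W \<in> W"
    and gf: "\<And>W i j. \<lbrakk>W \<in> topspace (transversal k F); i < k; j < k\<rbrakk> \<Longrightarrow>
           b (g i W) (f j) = (if i = j then 1 else 0)"
    using dual_frame[OF F] by metis
  define v where "v i z = (if i < k then g i (W z) else u z)" for i z
  have im: "(\<lambda>i. v i z) ` {..<Suc k} = insert (u z) ((\<lambda>i. g i (W z)) ` {..<k})" for z
    by (auto simp: v_def lessThan_Suc)
  have WT: "W z \<in> topspace (transversal k F)" if "z \<in> topspace Z" for z
    using W that by (auto simp: continuous_map_def)
  have sp: "span ((\<lambda>i. g i (W z)) ` {..<k}) = W z" if "z \<in> topspace Z" for z
    using span_dual_frame[of "W z" k "\<lambda>i. g i (W z)" f] gW[OF WT[OF that]] gf[OF WT[OF that]]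
      WT[OF that] by (simp add: topspace_transversal)
  have "continuous_map Z (grassmannian_topology (Suc k)) (\<lambda>z. span ((\<lambda>i. v i z) ` {..<Suc k}))"
  proof (rule continuous_map_span)
    show "continuous_map Z euclidean (v i)" if "i < Suc k" for i
    proof (cases "i < k")
      case True
      then show ?thesis
        using continuous_map_compose[OF W cg[OF True]] by (simp add: v_def[abs_def] o_def)
    qed (use u in \<open>simp add: v_def[abs_def]\<close>)
    fix z assume z: "z \<in> topspace Z"
    have di: "inj_on (\<lambda>i. g i (W z)) {..<k} \<and> independent ((\<lambda>i. g i (W z)) ` {..<k})"
      using gf[OF WT[OF z]] by (intro dual_frame_independent)
    have "independent ((\<lambda>i. v i z) ` {..<Suc k})"
      unfolding im using di uW[OF z] sp[OF z] by (intro independent_insertI) auto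
    moreover have "inj_on (\<lambda>i. v i z) {..<Suc k}"
    proof (rule eq_card_imp_inj_on)
      have "u z \<notin> (\<lambda>i. g i (W z)) ` {..<k}" using uW[OF z] gW[OF WT[OF z]] by auto
      then show "card ((\<lambda>i. v i z) ` {..<Suc k}) = card {..<Suc k}"
        unfolding im using di by (simp add: card_image)
    qed simp
    ultimately show "inj_on (\<lambda>i. v i z) {..<Suc k} \<and> independent ((\<lambda>i. v i z) ` {..<Suc k})" by blast
  qed
  moreover have "span ((\<lambda>i. v i z) ` {..<Suc k}) = span (insert (u z) (W z))" if "z \<in> topspace Z" for z
    unfolding im using span_insert_span[of "u z" "(\<lambda>i. g i (W z)) ` {..<k}"] sp[OF that] by simp
  ultimately show ?thesis by (rule continuous_map_eq)
qed

text \<open>A fixed \<open>x\<close> in \<open>F'\<close> outside \<open>F\<close> is projected to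
  \<open>W\<^sup>\<bottom>\<close> along \<open>F\<close>, which keeps it in \<open>F'\<close>. If
  the result were in \<open>W\<close>, isotropy of \<open>F'\<close> would put it in
  \<open>W \<inter> F\<^sup>\<bottom>\<close>, so it would be zero and \<open>x\<close> would lie in
  \<open>F\<close>.\<close>

lemma continuous_isotropic_line:
  assumes F: "F \<in> grassmannian k" and F': "F' \<in> grassmannian (Suc k)"
    and sub: "F \<subseteq> F'" and iso: "isotropic b F'"
  obtains l where "continuous_map (transversal k F) euclidean l"
    and "\<And>W. W \<in> topspace (transversal k F) \<Longrightarrow> l W \<in> F' \<and> l W \<in> orth_compl b W \<and> l W \<notin> W"
proof -
  have "F \<noteq> F'" using grassmannianD(2)[OF F] grassmannianD(2)[OF F'] by auto
  then obtain x where x: "x \<in> F'" "x \<notin> F" using sub by blast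
  obtain Q where Q: "continuous_map (transversal k F) euclidean Q"
    "\<And>W. W \<in> topspace (transversal k F) \<Longrightarrow> Q W \<in> orth_compl b W"
    "\<And>W. W \<in> topspace (transversal k F) \<Longrightarrow> x - Q W \<in> F"
    using continuous_orth_proj[OF F] by metis
  show ?thesis
  proof (rule that[OF Q(1)], intro conjI)
    fix W assume W: "W \<in> topspace (transversal k F)"
    show "Q W \<in> orth_compl b W" using Q(2)[OF W] .
    have "x - (x - Q W) \<in> F'"
      using x(1) Q(3)[OF W] sub grassmannianD(1)[OF F'] by (meson subsetD subspace_diff)
    then show QF': "Q W \<in> F'" by simp
    show "Q W \<notin> W"
    proof
      assume "Q W \<in> W"
      moreover have "Q W \<in> orth_compl b F"
        using QF' iso orth_compl_anti[OF sub] unfolding isotropic_orth_compl by blast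
      ultimately have "Q W = 0" using W by (auto simp: topspace_transversal)
      then show False using Q(3)[OF W] x(2) by simp
    qed
  qed
qed

end

section \<open>Flags over a given flag\<close>

context nondegenerate_symmetric
begin

lemma Omega_iff:
  assumes F: "F \<in> isotropic_flags b k"
  shows "G \<in> Omega b k F \<longleftrightarrow>
    G \<in> isotropic_flags b k \<and> (\<forall>j\<in>{1..k}. G j \<inter> orth_compl b (F j) = {0})"
proof -
  have "{x + y |x y. x \<in> G j \<and> y \<in> orth_compl b (F j)} = UNIV"
    if "G \<in> isotropic_flags b k" "j \<in> {1..k}" "G j \<inter> orth_compl b (F j) = {0}" for j
  proof -
    have "G j \<in> grassmannian j" "F j \<in> grassmannian j"
      using that F by (auto simp: isotropic_flags_def PiE_iff)
    then show ?thesis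
      using that(3) by (intro sum_orth_compl) (auto simp: grassmannian_def)
  qed
  then show ?thesis
    unfolding Omega_def transverse_def by blast
qed

lemma topspace_Omega2_space: "topspace (Omega2_space b k F G) = Omega b k F \<inter> Omega b k G"
  by (auto simp: Omega2_space_def topspace_flag_space Omega_def)

lemma continuous_map_Omega2_space:
  assumes "\<And>j. j \<in> {1..k} \<Longrightarrow> continuous_map Z (grassmannian_topology j) (\<lambda>z. H z j)"
    and "\<And>z. z \<in> topspace Z \<Longrightarrow> H z \<in> Omega b k F \<inter> Omega b k G"
  shows "continuous_map Z (Omega2_space b k F G) H"
  unfolding Omega2_space_def flag_space_def
proof (intro continuous_map_into_subtopology)
  have fl: "H z \<in> isotropic_flags b k" if "z \<in> topspace Z" for z
    using assms(2)[OF that] by (auto simp: Omega_def)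
  show "continuous_map Z (product_topology grassmannian_topology {1..k}) H"
    unfolding continuous_map_componentwise
    using assms(1) fl by (auto simp: isotropic_flags_def PiE_iff)
  show "H \<in> topspace Z \<rightarrow> isotropic_flags b k" using fl by auto
qed (use assms(2) in auto)

lemma continuous_map_Omega2_component:
  assumes "j \<in> {1..k}"
  shows "continuous_map (Omega2_space b k F G) (grassmannian_topology j) (\<lambda>H. H j)"
  unfolding Omega2_space_def flag_space_def
  using assms by (intro continuous_map_from_subtopology continuous_map_product_projection)

end

text \<open>Here \<open>k + 1\<close> plays the role of \<open>q\<close>, and \<open>l F W\<close> spans the line \<open>F\<^sup>k\<^sup>+\<^sup>1 \<inter> W\<^sup>\<bottom>\<close>.\<close>

locale flag_extension = cartesian_form b for b :: "real ^ 'n \<Rightarrow> real ^ 'n \<Rightarrow> real" +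
  fixes p k :: nat and F0 Finf :: "nat \<Rightarrow> (real ^ 'n) set"
    and l :: "(nat \<Rightarrow> (real ^ 'n) set) \<Rightarrow> (real ^ 'n) set \<Rightarrow> real ^ 'n"
  assumes k: "k \<ge> 1" and pk: "p > k + 2" and card: "CARD('n) = p + Suc k"
    and sig: "has_signature b p (Suc k)"
    and F0: "F0 \<in> isotropic_flags b (Suc k)" and Finf: "Finf \<in> isotropic_flags b (Suc k)"
    and cl: "F \<in> {F0, Finf} \<Longrightarrow> continuous_map (transversal k (F k)) euclidean (l F)"
    and l: "\<lbrakk>F \<in> {F0, Finf}; W \<in> topspace (transversal k (F k))\<rbrakk> \<Longrightarrow>
      l F W \<in> F (Suc k) \<and> l F W \<in> orth_compl b W \<and> l F W \<notin> W"
begin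

abbreviation "X \<equiv> Omega2_space b (Suc k) F0 Finf"
abbreviation "Y \<equiv> Omega2_space b k (forget k F0) (forget k Finf)"

section \<open>Parametrising the flags over \<open>G\<close> by isotropic vectors\<close>

definition extend :: "(nat \<Rightarrow> (real ^ 'n) set) \<Rightarrow> real ^ 'n \<Rightarrow> nat \<Rightarrow> (real ^ 'n) set" where
  "extend G u = G(Suc k := span (insert u (G k)))"

text \<open>These vectors describe the fibre: \<open>extend_in_X\<close> shows that they give points
  of \<open>X\<close>, and \<open>extend_cases\<close> that every point of \<open>X\<close> arises
  so.\<close>

definition adm :: "(real ^ 'n) set \<Rightarrow> real ^ 'n \<Rightarrow> bool" where
  "adm W u \<longleftrightarrow> u \<in> orth_compl b W \<and> b u u = 0 \<and> (\<forall>F\<in>{F0, Finf}. b u (l F W) \<noteq> 0)"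

text \<open>Outside this subspace, \<open>nullify\<close> cannot land on the line of
  \<open>Finf\<close>. The two lines may coincide modulo \<open>W\<close>, so its dimension is only
  bounded above.\<close>

definition bad :: "(real ^ 'n) set \<Rightarrow> (real ^ 'n) set" where
  "bad W = span (insert (l F0 W) (insert (l Finf W) W))"

lemma flagD:
  assumes "F \<in> {F0, Finf}"
  shows "F \<in> isotropic_flags b (Suc k)"
    and "\<And>j. j \<in> {1..Suc k} \<Longrightarrow> F j \<in> grassmannian j"
    and "F k \<subseteq> F (Suc k)" and "isotropic b (F (Suc k))"
    and "forget k F \<in> isotropic_flags b k"
proof -
  show *: "F \<in> isotropic_flags b (Suc k)" using assms F0 Finf by auto
  then show "forget k F \<in> isotropic_flags b k" by (rule forget_isotropic_flags[rotated]) simp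
  show "\<And>j. j \<in> {1..Suc k} \<Longrightarrow> F j \<in> grassmannian j" "F k \<subseteq> F (Suc k)" "isotropic b (F (Suc k))"
    using * k by (auto simp: isotropic_flags_def PiE_iff)
qed

lemma topspace_X:
  "H \<in> topspace X \<longleftrightarrow> H \<in> isotropic_flags b (Suc k) \<and>
     (\<forall>F\<in>{F0, Finf}. \<forall>j\<in>{1..Suc k}. H j \<inter> orth_compl b (F j) = {0})"
  using Omega_iff[OF F0] Omega_iff[OF Finf] by (auto simp: topspace_Omega2_space)

lemma topspace_Y:
  "G \<in> topspace Y \<longleftrightarrow> G \<in> isotropic_flags b k \<and>
     (\<forall>F\<in>{F0, Finf}. \<forall>j\<in>{1..k}. G j \<inter> orth_compl b (F j) = {0})"
  using Omega_iff[OF flagD(5)[of F0]] Omega_iff[OF flagD(5)[of Finf]]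
  by (auto simp: topspace_Omega2_space forget_def)

lemma Y_top:
  assumes "G \<in> topspace Y"
  shows "G k \<in> grassmannian k" "isotropic b (G k)" "subspace (G k)" "dim (G k) = k"
    and "F \<in> {F0, Finf} \<Longrightarrow> G k \<in> topspace (transversal k (F k))"
proof -
  show G: "G k \<in> grassmannian k" "isotropic b (G k)"
    using assms k by (auto simp: topspace_Y isotropic_flags_def PiE_iff)
  then show "subspace (G k)" "dim (G k) = k" by (auto simp: grassmannian_def)
  show "F \<in> {F0, Finf} \<Longrightarrow> G k \<in> topspace (transversal k (F k))"
    using assms k G by (auto simp: topspace_Y topspace_transversal)
qed

lemma continuous_map_top:
  assumes "F \<in> {F0, Finf}"
  shows "continuous_map Y (transversal k (F k)) (\<lambda>G. G k)"
  unfolding transversal_def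
proof (rule continuous_map_into_subtopology)
  show "continuous_map Y (grassmannian_topology k) (\<lambda>G. G k)"
    using k by (intro continuous_map_Omega2_component) auto
  show "(\<lambda>G. G k) \<in> topspace Y \<rightarrow> {W \<in> grassmannian k. W \<inter> orth_compl b (F k) = {0}}"
    using Y_top(5)[OF _ assms] by (auto simp: topspace_transversal)
qed

lemma l_isotropic:
  assumes "F \<in> {F0, Finf}" "G \<in> topspace Y"
  shows "l F (G k) \<in> F (Suc k)" "l F (G k) \<in> orth_compl b (G k)" "l F (G k) \<notin> G k"
    "b (l F (G k)) (l F (G k)) = 0" "l F (G k) \<noteq> 0"
proof -
  show *: "l F (G k) \<in> F (Suc k)" "l F (G k) \<in> orth_compl b (G k)" "l F (G k) \<notin> G k"
    using l[OF assms(1) Y_top(5)[OF assms(2,1)]] by auto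
  then show "b (l F (G k)) (l F (G k)) = 0"
    using flagD(4)[OF assms(1)] by (auto simp: isotropic_def)
  show "l F (G k) \<noteq> 0"
    using *(3) subspace_0[OF Y_top(3)[OF assms(2)]] by metis
qed

lemma adm_notin:
  assumes "G \<in> topspace Y" "adm (G k) u"
  shows "u \<notin> G k"
proof
  assume "u \<in> G k"
  then have "b (l F0 (G k)) u = 0"
    using l_isotropic(2)[of F0 G] assms(1) by (simp add: orth_compl_def)
  then show False using assms(2) b_sym[of u "l F0 (G k)"] by (simp add: adm_def)
qed

lemma forget_extend:
  assumes "G \<in> topspace Y" shows "forget k (extend G u) = G"
proof -
  have "G \<in> isotropic_flags b k" using assms unfolding topspace_Y by blast
  then show ?thesis
    by (auto simp: isotropic_flags_def PiE_iff extensional_def fun_eq_iff forget_def extend_def)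
qed

lemma extend_scale: "c \<noteq> 0 \<Longrightarrow> extend G (c *\<^sub>R u) = extend G u"
  by (simp add: extend_def span_insert_scale)

text \<open>The conditions up to step \<open>k\<close> are inherited from \<open>G\<close>; the new
  one is \<open>insert_transverse\<close> applied to the line of each flag.\<close>

lemma extend_in_X:
  assumes G: "G \<in> topspace Y" and u: "adm (G k) u"
  shows "extend G u \<in> topspace X"
  unfolding topspace_X
proof (intro conjI ballI)
  let ?H = "span (insert u (G k))"
  have "dim ?H = Suc k"
    using adm_notin[OF G u] Y_top(3,4)[OF G] by (simp add: dim_insert span_eq_iff[THEN iffD2])
  moreover have "isotropic b ?H"
    using u Y_top(2)[OF G] by (intro isotropic_span) (auto simp: isotropic_insert adm_def)
  moreover have "G k \<subseteq> ?H" by (auto intro: span_base)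
  moreover have "G \<in> isotropic_flags b k" using G by (simp add: topspace_Y)
  ultimately show "extend G u \<in> isotropic_flags b (Suc k)"
    using k by (fastforce simp: extend_def isotropic_flags_def PiE_iff extensional_def
        grassmannian_def le_Suc_eq)
  fix F j assume F: "F \<in> {F0, Finf}" and j: "j \<in> {1..Suc k}"
  show "extend G u j \<inter> orth_compl b (F j) = {0}"
  proof (cases "j = Suc k")
    case True
    have "?H \<inter> orth_compl b (F (Suc k)) = {0}"
    proof (rule insert_transverse)
      show "G k \<inter> orth_compl b (F k) = {0}"
        using Y_top(5)[OF G F] by (simp add: topspace_transversal)
      show "b u (l F (G k)) \<noteq> 0" using u F by (auto simp: adm_def)
    qed (use Y_top(3)[OF G] flagD(3)[OF F] l_isotropic[OF F G] in auto)
    then show ?thesis using True by (simp add: extend_def)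
  next
    case False
    then have "j \<in> {1..k}" using j by auto
    then have "G j \<inter> orth_compl b (F j) = {0}" using G F unfolding topspace_Y by blast
    then show ?thesis using False by (simp add: extend_def)
  qed
qed

lemma forget_in_Y: "H \<in> topspace X \<Longrightarrow> forget k H \<in> topspace Y"
  unfolding topspace_X topspace_Y using forget_isotropic_flags[of k "Suc k" H b]
  by (simp add: forget_def)

text \<open>Any vector of \<open>H (Suc k)\<close> outside \<open>H k\<close> serves, with
  \<open>insert_transverse_imp\<close> giving the two nonzero pairings.\<close>

lemma extend_cases:
  assumes H: "H \<in> topspace X"
  obtains u where "adm (H k) u" "H = extend (forget k H) u"
proof -
  define G where "G = forget k H"
  have G: "G \<in> topspace Y" and Gk: "G k = H k"
    using forget_in_Y[OF H] k by (auto simp: G_def forget_def)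
  have fl: "H \<in> isotropic_flags b (Suc k)" using H by (simp add: topspace_X)
  then have HS: "H (Suc k) \<in> grassmannian (Suc k)" "H k \<subseteq> H (Suc k)" "isotropic b (H (Suc k))"
    using k by (auto simp: isotropic_flags_def PiE_iff)
  have "H k \<noteq> H (Suc k)"
    using Y_top(4)[OF G] grassmannianD(2)[OF HS(1)] by (auto simp: Gk)
  then obtain u where u: "u \<in> H (Suc k)" "u \<notin> H k" using HS(2) by blast
  have dim: "dim (span (insert u (H k))) = Suc k"
    using u Y_top(3,4)[OF G] by (simp add: Gk dim_insert span_eq_iff[THEN iffD2])
  have sp: "span (insert u (H k)) = H (Suc k)"
  proof (rule subspace_dim_equal)
    show "span (insert u (H k)) \<subseteq> H (Suc k)"
      using u HS grassmannianD(1)[OF HS(1)] by (intro span_minimal) auto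
    show "dim (H (Suc k)) \<le> dim (span (insert u (H k)))"
      using dim grassmannianD(2)[OF HS(1)] by simp
  qed (use grassmannianD(1)[OF HS(1)] in auto)
  have "b u (l F (H k)) \<noteq> 0" if F: "F \<in> {F0, Finf}" for F
  proof (rule insert_transverse_imp)
    show "span (insert u (H k)) \<inter> orth_compl b (F (Suc k)) = {0}"
      using H F unfolding sp by (auto simp: topspace_X)
    show "subspace (F (Suc k))" "dim (span (insert u (H k))) = dim (F (Suc k))"
      using flagD(2)[OF F, of "Suc k"] dim by (auto simp: grassmannian_def)
  qed (use l_isotropic[OF F G] Gk in auto)
  moreover have "u \<in> orth_compl b (H k)" "b u u = 0"
    using HS u by (auto simp: isotropic_def orth_compl_def)
  ultimately have "adm (H k) u" by (simp add: adm_def)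
  moreover have "H = extend G u"
  proof
    fix j show "H j = extend G u j"
      using fl sp Gk unfolding extend_def G_def
      by (auto simp: forget_def isotropic_flags_def PiE_iff extensional_def restrict_def)
  qed
  ultimately show ?thesis unfolding G_def by (rule that)
qed

lemma continuous_map_extend:
  assumes G: "continuous_map Z Y G" and u: "continuous_map Z euclidean u"
    and adm: "\<And>z. z \<in> topspace Z \<Longrightarrow> adm (G z k) (u z)"
  shows "continuous_map Z X (\<lambda>z. extend (G z) (u z))"
proof (rule continuous_map_Omega2_space)
  have GY: "G z \<in> topspace Y" if "z \<in> topspace Z" for z
    using G that by (auto simp: continuous_map_def)
  show "extend (G z) (u z) \<in> Omega b (Suc k) F0 \<inter> Omega b (Suc k) Finf" if "z \<in> topspace Z" for z
    using extend_in_X[OF GY adm] that by (simp add: topspace_Omega2_space)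
  fix j assume j: "j \<in> {1..Suc k}"
  show "continuous_map Z (grassmannian_topology j) (\<lambda>z. extend (G z) (u z) j)"
  proof (cases "j = Suc k")
    case True
    have "continuous_map Z (grassmannian_topology (Suc k)) (\<lambda>z. span (insert (u z) (G z k)))"
    proof (rule continuous_map_span_insert)
      show "F0 k \<in> grassmannian k" using flagD(2)[of F0 k] k by auto
      show "continuous_map Z (transversal k (F0 k)) (\<lambda>z. G z k)"
        using continuous_map_compose[OF G continuous_map_top[of F0]] by (simp add: o_def)
    qed (use u adm_notin[OF GY adm] in auto)
    then show ?thesis using True by (simp add: extend_def)
  next
    case False
    then have "continuous_map Y (grassmannian_topology j) (\<lambda>H. H j)"
      using j by (intro continuous_map_Omega2_component) auto
    from continuous_map_compose[OF G this] show ?thesis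
      using False by (simp add: extend_def o_def)
  qed
qed

section \<open>Path connectedness of the fibres\<close>

text \<open>Here \<open>p > q + 1\<close> enters: the complement of \<open>G k\<close> has dimension
  \<open>p + 1 \<ge> k + 4\<close>, and \<open>bad\<close> has dimension at most
  \<open>k + 2\<close>.\<close>

lemma dim_bad:
  assumes G: "G \<in> topspace Y"
  shows "dim (bad (G k)) + 2 \<le> dim (orth_compl b (G k))"
proof -
  have "dim (orth_compl b (G k)) + k = p + Suc k"
    using dim_orth_compl[OF Y_top(3)[OF G]] Y_top(4)[OF G] card by simp
  moreover have "dim (bad (G k)) \<le> k + 2"
    using Y_top(4)[OF G] by (simp add: bad_def dim_insert)
  ultimately show ?thesis using pk by simp
qed

text \<open>Only the pairing with the line of \<open>Finf\<close> is delicate. If it vanished,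
  \<open>isotropic_orthogonal_imp_span\<close> would place the nullified vector in the span of that
  line and \<open>G k\<close>, and solving for \<open>w\<close> would put \<open>w\<close> in
  \<open>bad\<close>.\<close>

lemma adm_nullify:
  assumes G: "G \<in> topspace Y" and w: "w \<in> orth_compl b (G k)" "w \<notin> bad (G k)" "b w (l F0 (G k)) \<noteq> 0"
  shows "adm (G k) (nullify (l F0 (G k)) w)"
proof -
  let ?l = "l F0 (G k)" and ?m = "l Finf (G k)"
  let ?u = "nullify ?l w"
  note l0 = l_isotropic[OF _ G, of F0, simplified] and m = l_isotropic[OF _ G, of Finf, simplified]
  have u: "?u \<in> orth_compl b (G k)" "b ?u ?u = 0"
    using w l0 by (auto intro: nullify_orth_compl nullify_isotropic)
  moreover have "b ?u ?l \<noteq> 0" using b_nullify[OF l0(4)] w by simp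
  moreover have "b ?u ?m \<noteq> 0"
  proof
    assume "b ?u ?m = 0"
    then have "?u \<in> span (insert ?m (G k))"
      using isotropic_orthogonal_imp_span[OF sig] card Y_top[OF G] m u by auto
    then have "?u \<in> bad (G k)"
      unfolding bad_def by (rule subsetD[OF span_mono, rotated]) auto
    moreover have "?l \<in> bad (G k)" by (simp add: bad_def span_base)
    ultimately have "?u + b w w *\<^sub>R ?l \<in> bad (G k)"
      unfolding bad_def by (intro span_add span_scale)
    then have "(2 * b w ?l) *\<^sub>R w \<in> bad (G k)" by (simp add: nullify_def)
    then have "inverse (2 * b w ?l) *\<^sub>R (2 * b w ?l) *\<^sub>R w \<in> bad (G k)"
      unfolding bad_def by (rule span_scale)
    then show False using w by simp
  qed
  ultimately show ?thesis by (simp add: adm_def)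
qed

text \<open>Write \<open>u\<close> as \<open>c l + d m\<close> plus a vector of \<open>G k\<close>.
  Then \<open>b u u\<close> is \<open>2 c d b(l,m)\<close>, while the pairings with \<open>l\<close>
  and \<open>m\<close> are \<open>d b(l,m)\<close> and \<open>c b(l,m)\<close>; these cannot both be
  nonzero when \<open>u\<close> is isotropic.\<close>

lemma adm_notin_bad:
  assumes G: "G \<in> topspace Y" and u: "adm (G k) u"
  shows "u \<notin> bad (G k)"
proof
  let ?l = "l F0 (G k)" and ?m = "l Finf (G k)"
  note l0 = l_isotropic[OF _ G, of F0, simplified] and m = l_isotropic[OF _ G, of Finf, simplified]
  assume "u \<in> bad (G k)"
  then obtain c where "u - c *\<^sub>R ?l \<in> span (insert ?m (G k))"
    unfolding bad_def span_insert[of ?l] by blast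
  then obtain d where "u - c *\<^sub>R ?l - d *\<^sub>R ?m \<in> span (G k)"
    unfolding span_insert[of ?m] by blast
  moreover define g where "g = u - c *\<^sub>R ?l - d *\<^sub>R ?m"
  ultimately have g: "g \<in> G k" "u = c *\<^sub>R ?l + d *\<^sub>R ?m + g"
    using Y_top(3)[OF G] by (simp_all add: span_eq_iff[THEN iffD2])
  have "b v g = 0" if "v \<in> orth_compl b (G k)" for v
    using that g by (simp add: orth_compl_def)
  then have g0: "b u g = 0" "b g ?l = 0" "b g ?m = 0"
    using u l0(2) m(2) by (auto simp: adm_def b_sym[of g])
  have "b u ?l = d * b ?l ?m" "b u ?m = c * b ?l ?m"
    using g(2) g0 l0(4) m(4) by (simp_all add: b_simps b_sym[of ?m ?l])
  moreover have "b u u = c * b u ?l + d * b u ?m"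
    using g0(1) by (subst (2) g(2)) (simp add: b_simps)
  ultimately show False using u by (auto simp: adm_def)
qed

text \<open>The fibre is the continuous image of the path connected set \<open>S\<close> under
  \<open>nullify\<close> followed by \<open>extend\<close>.\<close>

lemma path_component_fibre:
  assumes H: "H \<in> topspace X" "H' \<in> topspace X" and eq: "forget k H = forget k H'"
  shows "path_component_of X H H'"
proof -
  define G where "G = forget k H"
  have G: "G \<in> topspace Y" "H k = G k" "H' k = G k"
    using forget_in_Y[OF H(1)] fun_cong[OF eq, of k] k by (auto simp: G_def forget_def)
  define S where "S = {w \<in> orth_compl b (G k). w \<notin> bad (G k) \<and> b (l F0 (G k)) w > 0}"
  have S: "\<exists>w\<in>S. K = extend G (nullify (l F0 (G k)) w)" if K: "K \<in> topspace X" "forget k K = G" for K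
  proof -
    have Kk: "K k = G k" using fun_cong[OF K(2), of k] k by (auto simp: forget_def)
    obtain u where u: "adm (G k) u" "K = extend G u"
      using extend_cases[OF K(1)] Kk K(2) by metis
    \<comment> \<open>Scaling leaves the flag unchanged, so the sign of the pairing with
      \<open>l F0 (G k)\<close> can be made positive; a single half-space then suffices.\<close>
    define c where "c = sgn (b (l F0 (G k)) u)"
    have c: "c \<noteq> 0" using u by (auto simp: c_def adm_def sgn_zero_iff b_sym[of "l F0 (G k)"])
    have "adm (G k) (c *\<^sub>R u)"
      using u(1) c by (auto simp: adm_def b_simps subspace_scale[OF subspace_orth_compl])
    moreover have pos: "b (l F0 (G k)) (c *\<^sub>R u) > 0"
      using c by (simp add: c_def b_simps sgn_if split: if_splits)
    ultimately have "c *\<^sub>R u \<in> S"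
      using adm_notin_bad[OF G(1)] by (auto simp: S_def adm_def)
    \<comment> \<open>On an isotropic vector \<open>nullify\<close> is just a scaling, so it returns
      the same flag.\<close>
    moreover have "nullify (l F0 (G k)) (c *\<^sub>R u) = (2 * b (c *\<^sub>R u) (l F0 (G k)) * c) *\<^sub>R u"
      using u(1) by (simp add: nullify_def adm_def b_simps)
    moreover have "2 * b (c *\<^sub>R u) (l F0 (G k)) * c \<noteq> 0"
      using pos c b_sym by (metis mult_eq_0_iff order_less_irrefl zero_neq_numeral)
    ultimately show ?thesis using u(2) extend_scale by (intro bexI[of _ "c *\<^sub>R u"]) auto
  qed
  obtain w where w: "w \<in> S" "H = extend G (nullify (l F0 (G k)) w)"
    using S[OF H(1)] by (auto simp: G_def)
  obtain w' where w': "w' \<in> S" "H' = extend G (nullify (l F0 (G k)) w')"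
    using S[OF H(2)] eq by (auto simp: G_def)
  have "path_connected S"
    unfolding S_def
    using path_connected_halfspace_diff(1)[OF subspace_orth_compl _ dim_bad[OF G(1)] b_linear]
    by (simp add: bad_def)
  then obtain g where g: "path g" "path_image g \<subseteq> S" "pathstart g = w" "pathfinish g = w'"
    using w w' unfolding path_connected_def by blast
  have gS: "g t \<in> S" if "t \<in> {0..1}" for t using g(2) that by (auto simp: path_image_def)
  have "continuous_map (top_of_set {0..1}) X (\<lambda>t. extend G (nullify (l F0 (G k)) (g t)))"
  proof (rule continuous_map_extend)
    show "continuous_map (top_of_set {0..1}) euclidean (\<lambda>t. nullify (l F0 (G k)) (g t))"
      using g(1) by (intro continuous_map_nullify) (auto simp: path_def)
    show "adm (G k) (nullify (l F0 (G k)) (g t))" if "t \<in> topspace (top_of_set {0..1})" for t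
      using gS[of t] that b_sym[of "g t"] by (intro adm_nullify[OF G(1)]) (auto simp: S_def)
  qed (use G in auto)
  then show ?thesis
    unfolding path_component_of_def pathin_def
    using g(3,4) w(2) w'(2)
    by (intro exI[of _ "\<lambda>t. extend G (nullify (l F0 (G k)) (g t))"]) (auto simp: pathstart_def pathfinish_def)
qed

section \<open>Nonempty fibres and local sections\<close>

text \<open>Since \<open>l F0 (G k)\<close> is outside \<open>G k\<close>, which is its own double
  complement, some vector of the complement pairs with it nontrivially. After a sign change it can
  be moved off \<open>bad\<close> inside the half-space.\<close>

lemma exists_good:
  assumes G: "G \<in> topspace Y"
  obtains w where "w \<in> orth_compl b (G k)" "w \<notin> bad (G k)" "b w (l F0 (G k)) \<noteq> 0"
proof -
  let ?l = "l F0 (G k)"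
  have "?l \<notin> orth_compl b (orth_compl b (G k))"
    using l_isotropic(3)[OF _ G] orth_compl_orth_compl[OF Y_top(3)[OF G]] by simp
  then obtain e where e: "e \<in> orth_compl b (G k)" "b ?l e \<noteq> 0" by (auto simp: orth_compl_def)
  define e' where "e' = sgn (b ?l e) *\<^sub>R e"
  have "e' \<in> orth_compl b (G k)" "b ?l e' > 0"
    using e by (auto simp: e'_def b_simps sgn_if subspace_neg[OF subspace_orth_compl])
  then obtain w where "w \<in> orth_compl b (G k)" "w \<notin> bad (G k)" "b ?l w > 0"
    using path_connected_halfspace_diff(2)[OF subspace_orth_compl _ dim_bad[OF G] b_linear]
    by (metis bad_def subspace_span)
  then show ?thesis using that b_sym by (metis order_less_irrefl)
qed

text \<open>A vector \<open>w\<close> good at \<open>G\<close> is projected to the complement of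
  each nearby \<open>H k\<close> and then nullified. Orthogonality and isotropy hold by
  construction; the remaining admissibility conditions are two nonvanishing pairings, hence
  open.\<close>

lemma local_section:
  assumes G: "G \<in> topspace Y"
  shows "\<exists>U s. openin Y U \<and> G \<in> U \<and> continuous_map (subtopology Y U) X s \<and> (\<forall>z\<in>U. forget k (s z) = z)"
proof -
  obtain w where w: "w \<in> orth_compl b (G k)" "w \<notin> bad (G k)" "b w (l F0 (G k)) \<noteq> 0"
    using exists_good[OF G] by blast
  have F0k: "F0 k \<in> grassmannian k" using flagD(2)[of F0 k] k by auto
  obtain Q where Q: "continuous_map (transversal k (F0 k)) euclidean Q"
    "\<And>W. W \<in> topspace (transversal k (F0 k)) \<Longrightarrow> Q W \<in> orth_compl b W"
    "\<And>W. W \<in> topspace (transversal k (F0 k)) \<Longrightarrow> w - Q W \<in> F0 k"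
    "\<And>W. \<lbrakk>W \<in> topspace (transversal k (F0 k)); w \<in> orth_compl b W\<rbrakk> \<Longrightarrow> Q W = w"
    by (rule continuous_orth_proj[OF F0k, of w]) (rule that)
  define u where "u H = nullify (l F0 (H k)) (Q (H k))" for H
  have cY: "continuous_map Y euclidean (\<lambda>H. l F (H k))" if "F \<in> {F0, Finf}" for F
    using continuous_map_compose[OF continuous_map_top[OF that] cl[OF that]] by (simp add: o_def)
  have "continuous_map Y euclidean (\<lambda>H. Q (H k))"
    using continuous_map_compose[OF continuous_map_top[of F0] Q(1)] by (simp add: o_def)
  then have cu: "continuous_map Y euclidean u"
    unfolding u_def using cY by (intro continuous_map_nullify) auto
  have o: "openin Y {H \<in> topspace Y. b (u H) (l F (H k)) \<noteq> 0}" if "F \<in> {F0, Finf}" for F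
    using openin_continuous_map_preimage[OF continuous_map_form[OF cu cY[OF that]], of "- {0}"]
    by (simp add: open_Compl)
  define U where "U = {H \<in> topspace Y. b (u H) (l F0 (H k)) \<noteq> 0} \<inter> {H \<in> topspace Y. b (u H) (l Finf (H k)) \<noteq> 0}"
  have U: "openin Y U" unfolding U_def by (intro openin_Int o) auto
  have UY: "U \<subseteq> topspace Y" by (auto simp: U_def)
  have "u G = nullify (l F0 (G k)) w"
    using Q(4)[OF Y_top(5)[OF G, of F0]] w(1) by (simp add: u_def)
  then have "adm (G k) (u G)" using adm_nullify[OF G w] by simp
  then have GU: "G \<in> U" using G by (auto simp: U_def adm_def)
  have adm: "adm (H k) (u H)" if "H \<in> U" for H
  proof -
    have H: "H \<in> topspace Y" using that UY by blast
    have "u H \<in> orth_compl b (H k)" "b (u H) (u H) = 0"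
      unfolding u_def using Q(2)[OF Y_top(5)[OF H, of F0]] l_isotropic[OF _ H, of F0]
      by (auto intro: nullify_orth_compl nullify_isotropic)
    then show ?thesis using that by (auto simp: adm_def U_def)
  qed
  have "continuous_map (subtopology Y U) X (\<lambda>H. extend H (u H))"
  proof (rule continuous_map_extend)
    show "continuous_map (subtopology Y U) Y (\<lambda>H. H)"
      using continuous_map_from_subtopology[OF continuous_map_id] by (simp add: id_def)
  qed (use cu adm in \<open>auto intro: continuous_map_from_subtopology\<close>)
  then show ?thesis
    using U GU forget_extend UY by (intro exI[of _ U] exI[of _ "\<lambda>H. extend H (u H)"]) auto
qed

lemma bij_pi0_forget:
  "bij_betw (pi0_map Y (forget k)) (path_components_of X) (path_components_of Y)"
proof (rule bij_betw_pi0_map[OF _ _ path_component_fibre local_section])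
  show "continuous_map X Y (forget k)" by (intro continuous_map_forget) simp
  show "\<exists>H\<in>topspace X. forget k H = G" if G: "G \<in> topspace Y" for G
    using exists_good[OF G] adm_nullify[OF G] extend_in_X[OF G] forget_extend[OF G] by metis
qed

end

section \<open>Assembling the bijection with \<open>k = q - 1\<close>\<close>

theorem proposition3p25:
  fixes b :: "real ^ 'n \<Rightarrow> real ^ 'n \<Rightarrow> real"
    and p q :: nat
    and F0 Finf :: "nat \<Rightarrow> (real ^ 'n) set"
  assumes "q \<ge> 2" and "p > q + 1"
    and "CARD('n) = p + q"
    and "symmetric_form b" and "nondegenerate_form b" and "has_signature b p q"
    and "F0 \<in> isotropic_flags b q" and "Finf \<in> isotropic_flags b q"
    and "transverse b q F0 Finf"
  shows "bij_betw
           (pi0_map (Omega2_space b (q - 1) (forget (q - 1) F0) (forget (q - 1) Finf)) (forget (q - 1)))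
           (path_components_of (Omega2_space b q F0 Finf))
           (path_components_of (Omega2_space b (q - 1) (forget (q - 1) F0) (forget (q - 1) Finf)))"
proof -
  define k where "k = q - 1"
  have q: "q = Suc k" "k \<ge> 1" using assms(1) by (auto simp: k_def)
  interpret cartesian_form b
    using assms by unfold_locales
  have "\<exists>l. continuous_map (transversal k (F k)) euclidean l \<and> (\<forall>W\<in>topspace (transversal k (F k)).
      l W \<in> F (Suc k) \<and> l W \<in> orth_compl b W \<and> l W \<notin> W)" if F: "F \<in> isotropic_flags b q" for F
  proof -
    have "F k \<in> grassmannian k" "F (Suc k) \<in> grassmannian (Suc k)" "F k \<subseteq> F (Suc k)"
      "isotropic b (F (Suc k))"
      using F q by (auto simp: isotropic_flags_def PiE_iff)
    then show ?thesis using continuous_isotropic_line by metis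
  qed
  \<comment> \<open>The lines are chosen for all flags at once, since the locale expects
    \<open>l\<close> to be indexed by the flag.\<close>
  then obtain l where l: "\<And>F. F \<in> isotropic_flags b q \<Longrightarrow>
      continuous_map (transversal k (F k)) euclidean (l F) \<and> (\<forall>W\<in>topspace (transversal k (F k)).
      l F W \<in> F (Suc k) \<and> l F W \<in> orth_compl b W \<and> l F W \<notin> W)"
    by metis
  interpret flag_extension b p k F0 Finf l
    using assms q l by unfold_locales auto
  show ?thesis using bij_pi0_forget by (simp add: q)
qed

end
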